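(* For any fixed $\epsilon > 0$, each of the problems Tournament Bounded Size Inversion and Tournament Prescribed Size Inversion, parameterized by $k+p$, admits a kernel of size at most $(1+ \epsilon)k^2 p^3$: there is a polynomial-time algorithm that, given an instance $(T,p,k)$, outputs an instance $(T',p,k)$ of the same problem that is a yes-instance if and only if $(T,p,k)$ is, and such that $T'$ has at most $(1+\epsilon)k^2p^3$ vertices.
   Context: For an oriented graph $D$ and $X\subseteq V(D)$, the inversion of $X$ reverses the orientation of every arc with both endpoints in $X$. A decycling family of $D$ is a family of vertex subsets whose successive inversion makes $D$ acyclic. Tournament Bounded Size Inversion: given a tournament $T$ and positive integers $p,k$, decide whether $T$ admits a decycling family of at most $k$ sets each of size at most $p$. Tournament Prescribed Size Inversion: given a tournament $T$ and positive integers $p,k$, decide whether $T$ admits a decycling family of at most $k$ sets each of size exactly $p$.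
   Formalization: The bound is stated as max(3, (1+ε)k²p³): for p = k = 1 and ε < 2 the original bound fails, since the directed triangle is a no-instance and every tournament on at most 2 vertices is a yes-instance; in all other cases the bound is unchanged. *)

theory Defs
  imports
    Complex_Main
    "HOL-Computational_Algebra.Polynomial"
    "HOL-Library.Log_Nat"
begin

section \<open>Tournaments and inversions\<close>

definition tournament :: "'a set \<Rightarrow> 'a rel \<Rightarrow> bool" where
  "tournament V A \<longleftrightarrow> finite V \<and> A \<subseteq> V \<times> V \<and> asym A \<and> total_on V A"

definition invert :: "'a set \<Rightarrow> 'a rel \<Rightarrow> 'a rel" where
  "invert X A = {(u, v). if u \<in> X \<and> v \<in> X then (v, u) \<in> A else (u, v) \<in> A}"

definition decycling_family :: "'a set \<Rightarrow> 'a rel \<Rightarrow> 'a set list \<Rightarrow> bool" where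
  "decycling_family V A Xs \<longleftrightarrow> set Xs \<subseteq> Pow V \<and> acyclic (fold invert Xs A)"

definition bounded_size_inversion :: "'a set \<Rightarrow> 'a rel \<Rightarrow> nat \<Rightarrow> nat \<Rightarrow> bool" where
  "bounded_size_inversion V A p k \<longleftrightarrow>
     (\<exists>Xs. decycling_family V A Xs \<and> length Xs \<le> k \<and> (\<forall>X\<in>set Xs. card X \<le> p))"

definition prescribed_size_inversion :: "'a set \<Rightarrow> 'a rel \<Rightarrow> nat \<Rightarrow> nat \<Rightarrow> bool" where
  "prescribed_size_inversion V A p k \<longleftrightarrow>
     (\<exists>Xs. decycling_family V A Xs \<and> length Xs \<le> k \<and> (\<forall>X\<in>set Xs. card X = p))"

section \<open>Polynomial-time algorithms\<close>

text \<open>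
  The machine model is a random access machine presented as a while language. The memory consists of
  named arrays of natural numbers, initially zero; a scalar is cell 0 of an array. Every assignment
  and every test costs one step. Addition and truncated subtraction are the only arithmetic
  operations, so each step increases the bit length of the largest stored number by at most a
  constant depending on the program. Hence unit cost is polynomially equivalent to Turing machine
  time. With unit-cost multiplication this would fail.
\<close>

type_synonym vname = string
type_synonym state = "vname \<Rightarrow> nat \<Rightarrow> nat"

datatype aexp = N nat | Cell vname aexp | Plus aexp aexp | Minus aexp aexp

datatype bexp = Less aexp aexp | Eq aexp aexp | Not bexp | And bexp bexp

datatype com =
    Skip
  | Assign vname aexp aexp \<comment> \<open>\<open>Assign x i e\<close> stores \<open>e\<close> in cell \<open>i\<close> of array \<open>x\<close>\<close>
  | Seq com com
  | If bexp com com
  | While bexp com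

fun aval :: "aexp \<Rightarrow> state \<Rightarrow> nat" where
  "aval (N n) s = n"
| "aval (Cell x i) s = s x (aval i s)"
| "aval (Plus a b) s = aval a s + aval b s"
| "aval (Minus a b) s = aval a s - aval b s"

fun bval :: "bexp \<Rightarrow> state \<Rightarrow> bool" where
  "bval (Less a b) s \<longleftrightarrow> aval a s < aval b s"
| "bval (Eq a b) s \<longleftrightarrow> aval a s = aval b s"
| "bval (Not b) s \<longleftrightarrow> \<not> bval b s"
| "bval (And a b) s \<longleftrightarrow> bval a s \<and> bval b s"

text \<open>\<open>exec c s t s'\<close>: started in \<open>s\<close>, the program \<open>c\<close> halts in \<open>s'\<close> after exactly \<open>t\<close> steps.\<close>

inductive exec :: "com \<Rightarrow> state \<Rightarrow> nat \<Rightarrow> state \<Rightarrow> bool" where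
  Skip: "exec Skip s 1 s"
| Assign: "exec (Assign x i e) s 1 (s(x := (s x)(aval i s := aval e s)))"
| Seq: "exec c1 s t1 s1 \<Longrightarrow> exec c2 s1 t2 s2 \<Longrightarrow> exec (Seq c1 c2) s (t1 + t2) s2"
| IfTrue: "bval b s \<Longrightarrow> exec c1 s t s' \<Longrightarrow> exec (If b c1 c2) s (t + 1) s'"
| IfFalse: "\<not> bval b s \<Longrightarrow> exec c2 s t s' \<Longrightarrow> exec (If b c1 c2) s (t + 1) s'"
| WhileFalse: "\<not> bval b s \<Longrightarrow> exec (While b c) s 1 s"
| WhileTrue: "bval b s \<Longrightarrow> exec c s t1 s1 \<Longrightarrow> exec (While b c) s1 t2 s2
    \<Longrightarrow> exec (While b c) s (t1 + t2 + 1) s2"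

definition init_state :: "nat list \<Rightarrow> state" where
  "init_state xs = (\<lambda>_ _. 0)
     (''in'' := (\<lambda>i. if i < length xs then xs ! i else 0),
      ''inlen'' := (\<lambda>i. if i = 0 then length xs else 0))"

definition out_list :: "state \<Rightarrow> nat list" where
  "out_list s = map (s ''out'') [0..<s ''outlen'' 0]"

text \<open>
  One step per output entry is charged on top of the running time, as untouched cells of the output
  array would otherwise come for free.
\<close>

definition computes_in_time :: "com \<Rightarrow> nat list \<Rightarrow> nat list \<Rightarrow> nat \<Rightarrow> bool" where
  "computes_in_time c xs ys t \<longleftrightarrow>
     (\<exists>t' s. exec c (init_state xs) t' s \<and> out_list s = ys \<and> t = t' + length ys)"

definition bit_size :: "nat list \<Rightarrow> nat" where
  "bit_size xs = (\<Sum>x\<leftarrow>xs. floorlog 2 x + 1)"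

section \<open>Kernels\<close>

text \<open>The vertices are numbered from 0 to \<open>n - 1\<close>; the arcs are listed as an adjacency matrix.\<close>

definition encode :: "nat \<Rightarrow> nat rel \<Rightarrow> nat \<Rightarrow> nat \<Rightarrow> nat list" where
  "encode n A p k = [n, p, k] @ [of_bool ((i, j) \<in> A). i \<leftarrow> [0..<n], j \<leftarrow> [0..<n]]"

text \<open>
  A kernelization that keeps both numbers \<open>p\<close> and \<open>k\<close>, and hence the parameter \<open>k + p\<close>, with output
  tournaments of at most \<open>f p k\<close> vertices.
\<close>

definition admits_kernel ::
    "(nat set \<Rightarrow> nat rel \<Rightarrow> nat \<Rightarrow> nat \<Rightarrow> bool) \<Rightarrow> (nat \<Rightarrow> nat \<Rightarrow> real) \<Rightarrow> bool" where
  "admits_kernel P f \<longleftrightarrow>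
     (\<exists>c. \<exists>q :: nat poly. \<forall>n A p k. tournament {..<n} A \<and> 1 \<le> p \<and> 1 \<le> k \<longrightarrow>
        (\<exists>n' A' t. computes_in_time c (encode n A p k) (encode n' A' p k) t \<and>
           t \<le> poly q (bit_size (encode n A p k)) \<and>
           tournament {..<n'} A' \<and>
           (P {..<n'} A' p k \<longleftrightarrow> P {..<n} A p k) \<and>
           real n' \<le> f p k))"

text \<open>
  For \<open>p = k = 1\<close> inversions have no effect, so the directed triangle is a no-instance, and every
  equivalent instance has at least three vertices. Thus no kernel has fewer than three vertices
  there, and \<open>(1 + \<epsilon>) * k\<^sup>2 * p\<^sup>3\<close> is not attainable for \<open>\<epsilon> < 2\<close>. A bound of the form
  \<open>max 3 ((1 + \<epsilon>) * k\<^sup>2 * p\<^sup>3)\<close> differs from it (for \<open>\<epsilon> > 0\<close>) in that single case only.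
\<close>

lemma acyclic_tournament_less_3:
  fixes n :: nat
  assumes "tournament {..<n} A" and "n < 3"
  shows "acyclic A"
proof (rule acyclic_subset)
  obtain "A \<subseteq> {..<n} \<times> {..<n}" and asym: "asym A"
    using assms(1) by (auto simp: tournament_def)
  have A: "x < 2 \<and> y < 2 \<and> x \<noteq> y \<and> (y, x) \<notin> A" if "(x, y) \<in> A" for x y
    using that \<open>A \<subseteq> _\<close> assms(2) asymD[OF asym, of x y] by auto
  show "A \<subseteq> (if (0, 1) \<in> A then {(0, 1)} else {(1, 0)})"
  proof clarify
    fix x y assume "(x, y) \<in> A"
    with A[OF this] show "(x, y) \<in> (if (0, 1) \<in> A then {(0, 1)} else {(1, 0)})"
      using less_2_cases[of x] less_2_cases[of y] by auto
  qed
  show "acyclic (if (0, 1) \<in> A then {(0, 1)} else {(1, 0 :: nat)})"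
    by (simp add: acyclic_insert acyclic_def[of "{}"])
qed

lemma invert_singleton:
  assumes "card X \<le> 1" and "finite X"
  shows "invert X A = A"
proof -
  have "\<exists>x. X \<subseteq> {x}"
    using assms card_1_singletonE[of X] by (cases "card X = 0") auto
  then show ?thesis
    by (auto simp: invert_def)
qed

lemma kernel_bound_1_1:
  assumes "admits_kernel P f"
    and P: "P \<in> {bounded_size_inversion, prescribed_size_inversion}"
  shows "3 \<le> f 1 1"
proof -
  define C :: "nat rel" where "C = {(0, 1), (1, 2), (2, 0)}"
  have "{..<3} = {0, 1, 2 :: nat}" by auto
  then have C: "tournament {..<3} C"
    by (auto simp: tournament_def C_def asym_on_def total_on_def)
  have "(0, 0) \<in> C\<^sup>+"
    by (rule trancl_trans[OF r_into_trancl[of 0 1]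
          trancl_trans[OF r_into_trancl[of 1 2] r_into_trancl[of 2 0]]])
       (simp_all add: C_def)
  then have "\<not> acyclic C"
    by (auto simp: acyclic_def)
  have fold: "fold invert Xs C = C"
    if "set Xs \<subseteq> Pow {..<3}" "\<forall>X\<in>set Xs. card X \<le> 1" for Xs
    using that by (induction Xs) (auto simp: invert_singleton finite_subset)
  have no: "\<not> P {..<3} C 1 1"
  proof
    assume "P {..<3} C 1 1"
    with P obtain Xs where Xs: "set Xs \<subseteq> Pow {..<3}" "acyclic (fold invert Xs C)"
      and "(\<forall>X\<in>set Xs. card X \<le> 1) \<or> (\<forall>X\<in>set Xs. card X = 1)"
      unfolding bounded_size_inversion_def prescribed_size_inversion_def decycling_family_def by blast
    then have "\<forall>X\<in>set Xs. card X \<le> 1" by auto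
    from fold[OF Xs(1) this] Xs(2) \<open>\<not> acyclic C\<close> show False by simp
  qed
  obtain c q where "\<forall>n A p k. tournament {..<n} A \<and> 1 \<le> p \<and> 1 \<le> k \<longrightarrow>
        (\<exists>n' A' t. computes_in_time c (encode n A p k) (encode n' A' p k) t \<and>
           t \<le> poly q (bit_size (encode n A p k)) \<and>
           tournament {..<n'} A' \<and>
           (P {..<n'} A' p k \<longleftrightarrow> P {..<n} A p k) \<and>
           real n' \<le> f p k)"
    using assms(1) unfolding admits_kernel_def by (elim exE)
  from this[rule_format, of 3 C 1 1, OF conjI[OF C conjI[OF le_refl le_refl]]] no
  obtain n A where n: "tournament {..<n} A" "\<not> P {..<n} A 1 1" "real n \<le> f 1 1"
    by blast
  have "P {..<n} A 1 1" if "acyclic A"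
    using P that
    by (auto simp: bounded_size_inversion_def prescribed_size_inversion_def decycling_family_def
             intro!: exI[of _ "[]"])
  then have "\<not> n < 3"
    using acyclic_tournament_less_3 n by blast
  with n(3) show ?thesis by simp
qed

lemma max_3_kernel_bound:
  fixes p k :: nat
  assumes "\<epsilon> \<ge> 0" "1 \<le> p" "1 \<le> k" "(p, k) \<noteq> (1, 1)"
  shows "max 3 ((1 + \<epsilon>) * real k ^ 2 * real p ^ 3) = (1 + \<epsilon>) * real k ^ 2 * real p ^ 3"
proof -
  have "4 \<le> k ^ 2 * p ^ 3"
  proof (cases "p = 1")
    case True
    then have "2 \<le> k" using assms by auto
    then show ?thesis using power_mono[of 2 k 2] True by simp
  next
    case False
    then have "2 \<le> p" using assms by auto
    then have "8 \<le> p ^ 3" using power_mono[of 2 p 3] by simp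
    then show ?thesis using assms mult_le_mono[of 1 "k ^ 2" 8 "p ^ 3"] by simp
  qed
  then have "4 \<le> real k ^ 2 * real p ^ 3"
    by (metis of_nat_le_iff of_nat_mult of_nat_numeral of_nat_power)
  moreover have "real k ^ 2 * real p ^ 3 \<le> (1 + \<epsilon>) * (real k ^ 2 * real p ^ 3)"
    using assms(1) by (simp add: mult_right_mono algebra_simps)
  ultimately show ?thesis by (simp add: mult.assoc)
qed

end

theory Submission
  imports Defs
begin

text \<open>
  Call \<open>v\<close> the twin successor of \<open>u\<close> if the in-neighbours of \<open>v\<close> are those of \<open>u\<close> together with \<open>u\<close>
  itself. A solution touches at most \<open>K = k * p\<close> vertices. In a chain of \<open>K + 1\<close> consecutive twins
  some vertex is therefore untouched, and deleting a vertex of the chain is the same, up to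
  relabelling, as deleting that one. Conversely, a solution of the smaller tournament either leaves a
  vertex of the chain untouched, which can then be doubled, or touches nothing but the chain, and then
  the tournament was acyclic from the start. So it suffices to keep the first \<open>K\<close> vertices of each
  maximal twin chain. In a yes-instance, untouched vertices that are consecutive in the final acyclic
  order are twins, and the at most \<open>K\<close> touched vertices cut this order into at most \<open>K + 1\<close> runs; hence
  at most \<open>K + K * (K + 1) = K * (K + 2)\<close> vertices are kept, and this is at most \<open>k\<^sup>2 * p\<^sup>3\<close> for
  \<open>p \<ge> 2\<close>. If more are kept, the output is a fixed no-instance. For \<open>p = 1\<close> inversions have no effect and
  \<open>k\<close> may be replaced by 1.
\<close>

section \<open>Inversions and twin chains\<close>

lemma in_fold_invert_untouched:
  assumes "u \<notin> \<Union> (set Xs) \<or> v \<notin> \<Union> (set Xs)"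
  shows "(u, v) \<in> fold invert Xs A \<longleftrightarrow> (u, v) \<in> A"
  using assms
proof (induction Xs arbitrary: A)
  case (Cons X Xs)
  have "(u, v) \<in> fold invert Xs (invert X A) \<longleftrightarrow> (u, v) \<in> invert X A"
    by (rule Cons.IH) (use Cons.prems in auto)
  also have "\<dots> \<longleftrightarrow> (u, v) \<in> A"
    using Cons.prems by (auto simp: invert_def)
  finally show ?case by simp
qed simp

lemma fold_invert_subset: "A \<subseteq> W \<times> W \<Longrightarrow> fold invert Xs A \<subseteq> W \<times> W"
proof (induction Xs arbitrary: A)
  case (Cons X Xs)
  have "invert X A \<subseteq> W \<times> W"
    using Cons.prems by (auto simp: invert_def split: if_splits)
  then show ?case using Cons.IH by simp
qed simp

lemma in_fold_invert_refl: "(u, u) \<in> fold invert Xs A \<longleftrightarrow> (u, u) \<in> A"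
proof (induction Xs arbitrary: A)
  case (Cons X Xs)
  show ?case by (simp add: Cons.IH) (simp add: invert_def)
qed simp

lemma tournament_invert:
  assumes "tournament V A"
  shows "tournament V (invert X A)"
  using assms
  by (auto simp: tournament_def invert_def total_on_def asym_on_def split: if_splits)

lemma tournament_fold_invert: "tournament V A \<Longrightarrow> tournament V (fold invert Xs A)"
  by (induction Xs arbitrary: A) (auto simp: tournament_invert)

text \<open>Inverting \<open>X\<close> below and its preimage above exchange the same two directions
  of the arc between \<open>u\<close> and \<open>v\<close>. Both directions are assumed because each
  inversion may swap them; other pairs do not enter, so \<open>A'\<close> and \<open>A\<close> need
  only agree on this one.\<close>

lemma in_fold_invert_pullback:
  assumes "u \<in> W" "v \<in> W" "(u, v) \<in> A' \<longleftrightarrow> (f u, f v) \<in> A" "(v, u) \<in> A' \<longleftrightarrow> (f v, f u) \<in> A"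
  shows "(u, v) \<in> fold invert (map (\<lambda>X. {w \<in> W. f w \<in> X}) Xs) A'
           \<longleftrightarrow> (f u, f v) \<in> fold invert Xs A"
  using assms
proof (induction Xs arbitrary: A A')
  case (Cons X Xs)
  show ?case
    unfolding list.map fold_simps comp_apply
    by (rule Cons.IH) (use Cons.prems in \<open>auto simp: invert_def\<close>)
qed simp

text \<open>Along a walk in \<open>A'\<close> the image either advances in \<open>A\<close> or stays
  put. A closed walk thus gives a cycle of \<open>A\<close>, or lies in one fibre of
  \<open>f\<close> and is a cycle of \<open>B\<close>.\<close>

lemma acyclic_if_fibres_acyclic:
  assumes "acyclic A" "acyclic B"
    and *: "\<And>u v. (u, v) \<in> A' \<Longrightarrow> (f u, f v) \<in> A \<or> f u = f v \<and> (u, v) \<in> B"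
  shows "acyclic A'"
proof -
  have "(f u, f v) \<in> A\<^sup>+ \<or> f u = f v \<and> (u, v) \<in> B\<^sup>+" if "(u, v) \<in> A'\<^sup>+" for u v
    using that
  proof (induction rule: trancl_induct)
    case (base y)
    then show ?case using *[of u y] by auto
  next
    case (step y z)
    then show ?case using *[of y z]
      by (metis trancl.trancl_into_trancl trancl.r_into_trancl)
  qed
  then show ?thesis
    using assms(1,2) unfolding acyclic_def by blast
qed

text \<open>\<open>C\<close> restricts the sizes of the inverted sets, so that both problems are instances.\<close>

definition solvable :: "(nat \<Rightarrow> bool) \<Rightarrow> 'a set \<Rightarrow> 'a rel \<Rightarrow> nat \<Rightarrow> bool" where
  "solvable C V A k \<longleftrightarrow>
     (\<exists>Xs. decycling_family V A Xs \<and> length Xs \<le> k \<and> (\<forall>X\<in>set Xs. C (card X)))"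

lemma solvable_if_acyclic: "acyclic A \<Longrightarrow> solvable C V A k"
  unfolding solvable_def decycling_family_def by (intro exI[of _ "[]"]) simp

text \<open>The tool for every transfer of solutions: the preimages of the inverted sets form a
  solution again. By \<open>surj\<close> and \<open>inj\<close>, \<open>f\<close> is bijective over
  the touched vertices, so preimages keep their exact sizes. A fibre with several vertices lies over
  an untouched vertex, so its arcs never change and stay acyclic by \<open>fibres\<close>.\<close>

lemma solvable_pullback:
  assumes Xs: "decycling_family V A Xs" "length Xs \<le> k" "\<forall>X\<in>set Xs. C (card X)"
    and A': "A' \<subseteq> W \<times> W"
    and hom: "\<And>u v. u \<in> W \<Longrightarrow> v \<in> W \<Longrightarrow> f u \<noteq> f v \<Longrightarrow> (u, v) \<in> A' \<longleftrightarrow> (f u, f v) \<in> A"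
    and fibres: "acyclic {(u, v) \<in> A'. f u = f v}"
    and surj: "\<Union> (set Xs) \<subseteq> f ` W"
    and inj: "inj_on f {w \<in> W. f w \<in> \<Union> (set Xs)}"
  shows "solvable C W A' k"
proof -
  define Ys where "Ys = map (\<lambda>X. {w \<in> W. f w \<in> X}) Xs"
  have card: "card {w \<in> W. f w \<in> X} = card X" if "X \<in> set Xs" for X
  proof -
    have "inj_on f {w \<in> W. f w \<in> X}"
      by (rule inj_on_subset[OF inj]) (use that in auto)
    moreover have "f ` {w \<in> W. f w \<in> X} = X"
      using surj that by auto
    ultimately show ?thesis
      using card_image by fastforce
  qed
  have "fold invert Ys A' \<subseteq> W \<times> W"
    by (rule fold_invert_subset[OF A'])
  have irrefl: "(u, u) \<notin> A'" for u
    using fibres unfolding acyclic_def by blast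
  have "acyclic (fold invert Ys A')"
  proof (rule acyclic_if_fibres_acyclic[OF _ fibres])
    show "acyclic (fold invert Xs A)"
      using Xs(1) by (simp add: decycling_family_def)
    fix u v assume uv: "(u, v) \<in> fold invert Ys A'"
    then have W: "u \<in> W" "v \<in> W"
      using \<open>fold invert Ys A' \<subseteq> W \<times> W\<close> by auto
    show "(f u, f v) \<in> fold invert Xs A \<or> f u = f v \<and> (u, v) \<in> {(u, v) \<in> A'. f u = f v}"
    proof (cases "f u = f v")
      case False
      then show ?thesis
        using in_fold_invert_pullback[OF W hom[OF W False] hom[OF W(2,1)], of Xs] uv
        by (auto simp: Ys_def)
    next
      case eq: True
      have "(u, v) \<in> A'"
      proof (cases "f u \<in> \<Union> (set Xs)")
        \<comment> \<open>A touched vertex is alone in its fibre, so the arc would be a loop, and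
          inversions create no loops.\<close>
        case True
        then have "u = v"
          using inj eq W by (auto simp: inj_on_def)
        with uv \<open>u = v\<close> show ?thesis
          using irrefl by (simp add: in_fold_invert_refl)
      next
        case False
        then have "u \<notin> \<Union> (set Ys)"
          by (auto simp: Ys_def)
        with uv show ?thesis
          by (simp add: in_fold_invert_untouched)
      qed
      with eq show ?thesis by simp
    qed
  qed
  moreover have "set Ys \<subseteq> Pow W" "length Ys \<le> k" "\<forall>Y\<in>set Ys. C (card Y)"
    using Xs card by (auto simp: Ys_def)
  ultimately show ?thesis
    unfolding solvable_def decycling_family_def by blast
qed

lemma solvable_relabel:
  assumes "bij_betw f W V" "A' \<subseteq> W \<times> W" "irrefl A'"
    and hom: "\<And>u v. u \<in> W \<Longrightarrow> v \<in> W \<Longrightarrow> (u, v) \<in> A' \<longleftrightarrow> (f u, f v) \<in> A"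
    and "solvable C V A k"
  shows "solvable C W A' k"
proof -
  obtain Xs where Xs: "decycling_family V A Xs" "length Xs \<le> k" "\<forall>X\<in>set Xs. C (card X)"
    using assms(5) by (auto simp: solvable_def)
  have "{(u, v) \<in> A'. f u = f v} = {}"
    using assms(1,2,3) by (auto simp: bij_betw_def inj_on_def irrefl_def)
  then have "acyclic {(u, v) \<in> A'. f u = f v}"
    by (simp only: acyclic_def) simp
  then show ?thesis
    using assms(1) Xs(1)
    by (intro solvable_pullback[OF Xs assms(2) hom])
      (auto simp: bij_betw_def decycling_family_def intro: inj_on_subset)
qed

lemma solvable_relabel_iff:
  assumes f: "bij_betw f W V" and "A' \<subseteq> W \<times> W" "irrefl A'" "A \<subseteq> V \<times> V" "irrefl A"
    and hom: "\<And>u v. u \<in> W \<Longrightarrow> v \<in> W \<Longrightarrow> (u, v) \<in> A' \<longleftrightarrow> (f u, f v) \<in> A"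
  shows "solvable C W A' k \<longleftrightarrow> solvable C V A k"
proof
  have V: "inv_into W f v \<in> W" "f (inv_into W f v) = v" if "v \<in> V" for v
    using f that by (auto simp: bij_betw_def inv_into_into f_inv_into_f)
  show "solvable C V A k" if "solvable C W A' k"
    by (rule solvable_relabel[OF bij_betw_inv_into[OF f] assms(4,5) _ that]) (simp add: V hom)
  show "solvable C W A' k" if "solvable C V A k"
    by (rule solvable_relabel[OF f assms(2,3) hom that])
qed

lemma card_Union_le_length_mult:
  assumes "length Xs \<le> k" "\<forall>X\<in>set Xs. card X \<le> (p::nat)"
  shows "card (\<Union> (set Xs)) \<le> k * p"
proof -
  have "card (\<Union> (set Xs)) \<le> (\<Sum>X\<in>set Xs. card X)"
    by (rule card_Union_le_sum_card)
  also have "\<dots> \<le> card (set Xs) * p"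
    using assms(2) sum_bounded_above[of "set Xs" card p] by simp
  also have "\<dots> \<le> k * p"
    using assms(1) card_length[of Xs] by (intro mult_le_mono1) linarith
  finally show ?thesis .
qed

text \<open>Sets with at most one vertex leave all arcs alone, so the number of sets is irrelevant.
  Finiteness excludes infinite sets, whose \<open>card\<close> is 0.\<close>

lemma solvable_size_1:
  assumes "finite V" "\<And>c. C c \<Longrightarrow> c \<le> 1"
  shows "solvable C V A k \<longleftrightarrow> acyclic A"
proof
  assume "solvable C V A k"
  then obtain Xs where Xs: "set Xs \<subseteq> Pow V" "\<forall>X\<in>set Xs. C (card X)" "acyclic (fold invert Xs A)"
    by (auto simp: solvable_def decycling_family_def)
  have "fold invert Xs A = A"
    using Xs(1,2) assms by (induction Xs) (auto simp: invert_singleton finite_subset)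
  with Xs(3) show "acyclic A" by simp
qed (rule solvable_if_acyclic)

section \<open>Chains of consecutive twins\<close>

definition twins :: "'a set \<Rightarrow> 'a rel \<Rightarrow> 'a rel" where
  "twins V A = {(u, v). u \<in> V \<and> v \<in> V \<and> (\<forall>w\<in>V. (w, v) \<in> A \<longleftrightarrow> (w, u) \<in> A \<or> w = u)}"

text \<open>\<open>K\<close> counts the links, so the chain has the \<open>K + 1\<close> vertices
  \<open>c 0\<close> to \<open>c K\<close>. \<open>c0\<close> covers the chain without
  links.\<close>

locale twin_chain =
  fixes V :: "'a set" and A c K
  assumes T: "tournament V A"
    and twins: "\<And>i. i < K \<Longrightarrow> (c i, c (Suc i)) \<in> twins V A"
    and c0: "c 0 \<in> V"
begin

lemma in_V: "i \<le> K \<Longrightarrow> c i \<in> V"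
  using twins[of "i - 1"] c0 by (cases i) (auto simp: twins_def)

text \<open>Each link adds exactly its tail to the in-neighbourhood, so the in-neighbourhoods
  telescope.\<close>

lemma arc_into:
  assumes "w \<in> V" "i \<le> K"
  shows "(w, c i) \<in> A \<longleftrightarrow> (w, c 0) \<in> A \<or> w \<in> c ` {..<i}"
  using assms(2)
proof (induction i)
  case (Suc i)
  then show ?case
    using twins[of i] assms(1) by (auto simp: twins_def lessThan_Suc)
qed simp

lemma irr: "(w, w) \<notin> A"
  using T by (meson asymD tournament_def)

lemma arc: 
  assumes "i \<le> K" "j \<le> K"
  shows "(c i, c j) \<in> A \<longleftrightarrow> i < j"
proof -
  have less: "(c i, c j) \<in> A" if "i < j" "j \<le> K" for i j
    using arc_into[of "c i" j] that in_V[of i] by auto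
  have "(c i, c j) \<notin> A" if "j \<le> i"
  proof (cases "i = j")
    case False
    then show ?thesis
      using less[of j i] that assms T by (auto simp: tournament_def dest: asymD)
  qed (simp add: irr)
  then show ?thesis using less assms by (auto simp: not_less[symmetric])
qed

lemma inj: "inj_on c {..K}"
proof (rule inj_onI)
  fix i j assume "i \<in> {..K}" "j \<in> {..K}" "c i = c j"
  then show "i = j"
    using arc[of i j] arc[of j i] irr[of "c j"] by (metis atMost_iff linorder_neqE_nat)
qed

text \<open>The chain is a module: by \<open>arc_into\<close>, the in-neighbourhoods of its vertices
  differ only inside the chain, and for arcs leaving the chain one passes to the reverse
  arc.\<close>

lemma arc_outside:
  assumes "w \<in> V" "w \<notin> c ` {..K}" "i \<le> K" "j \<le> K"
  shows "(w, c i) \<in> A \<longleftrightarrow> (w, c j) \<in> A" "(c i, w) \<in> A \<longleftrightarrow> (c j, w) \<in> A"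
proof -
  show *: "(w, c i) \<in> A \<longleftrightarrow> (w, c j) \<in> A"
    using arc_into[of w i] arc_into[of w j] assms by auto
  have "(c l, w) \<in> A \<longleftrightarrow> (w, c l) \<notin> A" if "l \<le> K" for l
    using T that assms in_V[of l] unfolding tournament_def total_on_def
    by (metis asymD atMost_iff image_eqI)
  then show "(c i, w) \<in> A \<longleftrightarrow> (c j, w) \<in> A"
    using * assms by simp
qed

text \<open>
  The inclusion that skips a vertex, the map that merges two neighbours, and the map that contracts
  the whole chain are all instances.
\<close>

lemma monotone_collapse:
  assumes "mono h" "\<And>i. i \<le> K \<Longrightarrow> h i \<le> K"
  obtains f where "\<And>i. i \<le> K \<Longrightarrow> f (c i) = c (h i)"
    and "\<And>w. w \<notin> c ` {..K} \<Longrightarrow> f w = w"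
    and "\<And>u v. u \<in> V \<Longrightarrow> v \<in> V \<Longrightarrow> f u \<noteq> f v \<Longrightarrow> (u, v) \<in> A \<longleftrightarrow> (f u, f v) \<in> A"
    and "acyclic {(u, v) \<in> A. f u = f v}"
proof
  define f where "f x = (if x \<in> c ` {..K} then c (h (inv_into {..K} c x)) else x)" for x
  show f_c: "f (c i) = c (h i)" if "i \<le> K" for i
    using that inj by (simp add: f_def)
  show f_w: "f w = w" if "w \<notin> c ` {..K}" for w
    using that by (simp add: f_def)
  show "(u, v) \<in> A \<longleftrightarrow> (f u, f v) \<in> A" if uv: "u \<in> V" "v \<in> V" "f u \<noteq> f v" for u v
  proof (cases "u \<in> c ` {..K}"; cases "v \<in> c ` {..K}")
    assume "u \<in> c ` {..K}" "v \<in> c ` {..K}"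
    then obtain i j where ij: "i \<le> K" "j \<le> K" "u = c i" "v = c j" by auto
    then have "h i \<noteq> h j" using uv f_c by auto
    \<comment> \<open>A monotone map preserves the order of two indices whose images are
      distinct.\<close>
    then have "h i < h j \<longleftrightarrow> i < j"
      using assms(1) by (metis leD leI le_less monoD)
    then show ?thesis
      using ij assms(2) arc f_c by simp
  next
    assume "u \<in> c ` {..K}" and v: "v \<notin> c ` {..K}"
    then obtain i where "i \<le> K" "u = c i" by blast
    then show ?thesis
      using arc_outside(2)[OF uv(2) v, of i "h i"] assms(2) f_c f_w[OF v] by simp
  next
    assume u: "u \<notin> c ` {..K}" and "v \<in> c ` {..K}"
    then obtain i where "i \<le> K" "v = c i" by blast
    then show ?thesis
      using arc_outside(1)[OF uv(1) u, of i "h i"] assms(2) f_c f_w[OF u] by simp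
  qed (use f_w in simp)
  \<comment> \<open>Only chain vertices share a fibre with another vertex, and arcs within the chain
    increase the index.\<close>
  have "{(u, v) \<in> A. f u = f v} \<subseteq> measure (inv_into {..K} c)"
  proof clarify
    fix u v assume uv: "(u, v) \<in> A" "f u = f v"
    then have "u \<in> c ` {..K} \<and> v \<in> c ` {..K}"
      using irr[of u] assms(2) unfolding f_def by (auto simp: inj split: if_splits)
    then obtain i j where ij: "i \<le> K" "j \<le> K" "u = c i" "v = c j"
      by blast
    then have "i < j"
      using uv(1) arc by simp
    with ij show "(u, v) \<in> measure (inv_into {..K} c)"
      using inj by simp
  qed
  then show "acyclic {(u, v) \<in> A. f u = f v}"
    by (meson acyclic_subset wf_acyclic wf_measure)
qed

text \<open>At most \<open>K\<close> vertices are touched. This is one less than the length of the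
  chain, which gives an untouched vertex for the forward direction; for the converse the shortened
  chain has exactly \<open>K\<close> vertices, so it can be fully touched only if nothing else
  is.\<close>

lemma solvable_delete_last:
  assumes "K > 0" "K = k * p" and C: "\<And>n. C n \<Longrightarrow> n \<le> p"
  shows "solvable C (V - {c K}) (Restr A (V - {c K})) k \<longleftrightarrow> solvable C V A k"
    (is "solvable C ?W ?B k \<longleftrightarrow> _")
proof
  assume "solvable C V A k"
  then obtain Xs where Xs: "decycling_family V A Xs" "length Xs \<le> k" "\<forall>X\<in>set Xs. C (card X)"
    by (auto simp: solvable_def)
  let ?U = "\<Union> (set Xs)"
  have "?U \<subseteq> V" using Xs(1) by (auto simp: decycling_family_def)
  then have "finite ?U" using T finite_subset by (auto simp: tournament_def)
  have "card ?U \<le> K"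
    using card_Union_le_length_mult[of Xs k p] Xs C assms(2) by simp
  moreover have "card (c ` {..K}) = Suc K"
    using inj by (simp add: card_image)
  ultimately have "\<not> c ` {..K} \<subseteq> ?U"
    using card_mono[OF \<open>finite ?U\<close>, of "c ` {..K}"] by auto
  then obtain j where j: "j \<le> K" "c j \<notin> ?U" by auto
  \<comment> \<open>On indices below \<open>K\<close> this skips \<open>j\<close>, so that
    \<open>?W\<close> is mapped onto \<open>V\<close> without the untouched \<open>c j\<close>. The
    \<open>min\<close> only keeps \<open>h K\<close> within the chain; \<open>c K\<close> is not in
    \<open>?W\<close>.\<close>
  define h where "h i = (if i < j then i else min K (Suc i))" for i
  obtain f where f: "\<And>i. i \<le> K \<Longrightarrow> f (c i) = c (h i)" "\<And>w. w \<notin> c ` {..K} \<Longrightarrow> f w = w"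
     "\<And>u v. u \<in> V \<Longrightarrow> v \<in> V \<Longrightarrow> f u \<noteq> f v \<Longrightarrow> (u, v) \<in> A \<longleftrightarrow> (f u, f v) \<in> A"
     "acyclic {(u, v) \<in> A. f u = f v}"
    by (rule monotone_collapse[of h]) (use j in \<open>auto simp: h_def mono_def\<close>)
  show "solvable C ?W ?B k"
  proof (rule solvable_pullback[OF Xs, where f = f])
    show "acyclic {(u, v) \<in> ?B. f u = f v}"
      by (rule acyclic_subset[OF f(4)]) auto
    show "\<Union> (set Xs) \<subseteq> f ` ?W"
    proof
      fix x assume x: "x \<in> ?U"
      show "x \<in> f ` ?W"
      proof (cases "x \<in> c ` {..K}")
        case False
        then show ?thesis using x \<open>?U \<subseteq> V\<close> f(2)[of x] by (auto simp: image_iff intro!: bexI[of _ x])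
      next
        case True
        then obtain i where i: "i \<le> K" "x = c i" by auto
        then have "i \<noteq> j" using x j by auto
        define l where "l = (if i < j then i else i - 1)"
        have "l < K" "h l = i"
          using i j \<open>i \<noteq> j\<close> by (auto simp: l_def h_def)
        then have "f (c l) = x" "c l \<in> ?W"
          using f(1)[of l] i in_V[of l] inj by (auto simp: inj_on_def)
        then show ?thesis by blast
      qed
    qed
    show "inj_on f {w \<in> ?W. f w \<in> ?U}"
    proof (rule inj_on_subset[of f ?W])
      show "inj_on f ?W"
      proof (rule inj_onI)
        fix x y assume xy: "x \<in> ?W" "y \<in> ?W" "f x = f y"
        have out: "f w \<notin> c ` {..K}" if "w \<notin> c ` {..K}" for w
          using that f(2) by simp
        have ins: "f w \<in> c ` {..K}" if "w \<in> c ` {..K}" for w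
          using that f(1) by (auto simp: h_def)
        show "x = y"
        proof (cases "x \<in> c ` {..K}")
          case False
          then show ?thesis using xy out ins f(2) by metis
        next
          case True
          then have "y \<in> c ` {..K}" using xy out ins by metis
          with True obtain i l where il: "i \<le> K" "l \<le> K" "x = c i" "y = c l" by auto
          then have "i < K" "l < K" using xy by (auto simp: le_less)
          moreover have "h i = h l"
            using xy il f(1) inj j by (auto simp: h_def inj_on_def)
          ultimately show ?thesis using il by (auto simp: h_def split: if_splits)
        qed
      qed
    qed auto
  qed (use f(3) in auto)
next
  assume "solvable C ?W ?B k"
  then obtain Xs where Xs: "decycling_family ?W ?B Xs" "length Xs \<le> k" "\<forall>X\<in>set Xs. C (card X)"
    by (auto simp: solvable_def)
  let ?U = "\<Union> (set Xs)"
  have U: "?U \<subseteq> ?W" using Xs(1) by (auto simp: decycling_family_def)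
  then have "finite ?U" using T finite_subset[of ?U ?W] by (auto simp: tournament_def)
  have "card ?U \<le> K"
    using card_Union_le_length_mult[of Xs k p] Xs C assms(2) by simp
  have cW: "c i \<in> ?W" if "i < K" for i
    using that in_V[of i] inj by (auto simp: inj_on_def)
  show "solvable C V A k"
  proof (cases "c ` {..<K} \<subseteq> ?U")
    case True
    have "card (c ` {..<K}) = K"
      using inj by (simp add: card_image inj_on_def)
    then have U_eq: "?U = c ` {..<K}"
      using True \<open>card ?U \<le> K\<close> \<open>finite ?U\<close> by (metis card_seteq)
    \<comment> \<open>Contract the chain to \<open>c 0\<close>. An arc between different fibres has
      an end outside the chain, which is untouched, so its image is still an arc of the acyclic
      \<open>fold invert Xs ?B\<close>.\<close>
    obtain f where f: "\<And>i. i \<le> K \<Longrightarrow> f (c i) = c 0" "\<And>w. w \<notin> c ` {..K} \<Longrightarrow> f w = w"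
      "\<And>u v. u \<in> V \<Longrightarrow> v \<in> V \<Longrightarrow> f u \<noteq> f v \<Longrightarrow> (u, v) \<in> A \<longleftrightarrow> (f u, f v) \<in> A"
      "acyclic {(u, v) \<in> A. f u = f v}"
      by (rule monotone_collapse[of "\<lambda>_. 0"]) auto
    have "acyclic A"
    proof (rule acyclic_if_fibres_acyclic[OF _ f(4)])
      show "acyclic (fold invert Xs ?B)"
        using Xs(1) by (simp add: decycling_family_def)
      fix u v assume uv: "(u, v) \<in> A"
      then have V: "u \<in> V" "v \<in> V" using T by (auto simp: tournament_def)
      have fW: "f w \<in> ?W" if "w \<in> V" for w
      proof (cases "w \<in> c ` {..K}")
        case True
        then show ?thesis using f(1) cW[OF \<open>K > 0\<close>] by (metis atMost_iff imageE)
      next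
        case False
        then show ?thesis using f(2)[OF False] that by (metis Diff_iff atMost_iff image_eqI order_refl singletonD)
      qed
      show "(f u, f v) \<in> fold invert Xs ?B \<or> f u = f v \<and> (u, v) \<in> {(u, v) \<in> A. f u = f v}"
      proof (cases "f u = f v")
        case False
        then have "u \<notin> c ` {..K} \<or> v \<notin> c ` {..K}" using f(1) by auto
        then have "f u \<notin> ?U \<or> f v \<notin> ?U"
          using f(2) unfolding U_eq by force
        moreover have "(f u, f v) \<in> ?B"
          using f(3)[OF V False] uv fW V by simp
        ultimately show ?thesis by (simp add: in_fold_invert_untouched)
      qed (use uv in simp)
    qed
    then show ?thesis by (rule solvable_if_acyclic)
  next
    case False
    then obtain j where j: "j < K" "c j \<notin> ?U" by auto
    \<comment> \<open>Both \<open>j\<close> and \<open>j + 1\<close> go to \<open>j\<close>: the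
      untouched vertex \<open>c j\<close> is doubled, and the rest of the chain moves down by
      one.\<close>
    define h where "h i = (if i \<le> j then i else i - 1)" for i
    obtain f where f: "\<And>i. i \<le> K \<Longrightarrow> f (c i) = c (h i)" "\<And>w. w \<notin> c ` {..K} \<Longrightarrow> f w = w"
      "\<And>u v. u \<in> V \<Longrightarrow> v \<in> V \<Longrightarrow> f u \<noteq> f v \<Longrightarrow> (u, v) \<in> A \<longleftrightarrow> (f u, f v) \<in> A"
      "acyclic {(u, v) \<in> A. f u = f v}"
      by (rule monotone_collapse[of h]) (auto simp: h_def mono_def)
    have hK: "h i < K" if "i \<le> K" for i using that j by (auto simp: h_def)
    have fW: "f w \<in> ?W" if "w \<in> V" for w
    proof (cases "w \<in> c ` {..K}")
      case True
      then show ?thesis using f(1) cW hK by (metis atMost_iff imageE)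
    next
      case False
      then show ?thesis using f(2)[OF False] that by (metis Diff_iff atMost_iff image_eqI order_refl singletonD)
    qed
    show ?thesis
    proof (rule solvable_pullback[OF Xs, where f = f])
      show "A \<subseteq> V \<times> V" using T by (simp add: tournament_def)
      show "(u, v) \<in> A \<longleftrightarrow> (f u, f v) \<in> ?B" if "u \<in> V" "v \<in> V" "f u \<noteq> f v" for u v
        using f(3)[OF that] fW that by simp
      show "acyclic {(u, v) \<in> A. f u = f v}" by (rule f(4))
      show "?U \<subseteq> f ` V"
      proof
        fix x assume x: "x \<in> ?U"
        show "x \<in> f ` V"
        proof (cases "x \<in> c ` {..K}")
          case False
          then show ?thesis using x U f(2)[of x] by (auto simp: image_iff intro!: bexI[of _ x])
        next
          case True
          then obtain i where i: "i \<le> K" "x = c i" by auto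
          then have "i < K" using x U by (auto simp: le_less)
          define l where "l = (if i \<le> j then i else Suc i)"
          have "l \<le> K" "h l = i"
            using \<open>i < K\<close> by (auto simp: l_def h_def)
          then show ?thesis
            using f(1)[of l] i in_V[of l] by (metis image_eqI)
        qed
      qed
      show "inj_on f {w \<in> V. f w \<in> ?U}"
      proof (rule inj_onI)
        fix x y assume xy: "x \<in> {w \<in> V. f w \<in> ?U}" "y \<in> {w \<in> V. f w \<in> ?U}" "f x = f y"
        have out: "f w \<notin> c ` {..K}" if "w \<notin> c ` {..K}" for w
          using that f(2) by simp
        have ins: "f w \<in> c ` {..K}" if "w \<in> c ` {..K}" for w
        proof -
          obtain i where i: "i \<le> K" "w = c i" using \<open>w \<in> c ` {..K}\<close> by blast
          have "h i \<in> {..K}" using hK[OF i(1)] by simp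
          then show ?thesis unfolding i(2) f(1)[OF i(1)] by (rule imageI)
        qed
        show "x = y"
        proof (cases "x \<in> c ` {..K}")
          case False
          then show ?thesis using xy out ins f(2) by metis
        next
          case True
          then have "y \<in> c ` {..K}" using xy out ins by metis
          with True obtain i l where il: "i \<le> K" "l \<le> K" "x = c i" "y = c l" by auto
          then have "c (h i) = c (h l)" using xy f(1) by simp
          then have "h i = h l"
            using il hK inj by (meson atMost_iff inj_onD less_imp_le)
          \<comment> \<open>The only indices merged by \<open>h\<close> go to \<open>j\<close>, but
            \<open>f x\<close> is touched and \<open>c j\<close> is not.\<close>
          moreover have "h i \<noteq> j"
            using xy il f(1) j by auto
          ultimately have "i = l"
            by (auto simp: h_def split: if_splits)
          then show ?thesis using il by simp
        qed
      qed
    qed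
  qed
qed

end

section \<open>Size of the reduced tournament\<close>

text \<open>A vertex has at least \<open>K\<close> predecessors in its maximal chain iff a path of
  \<open>K\<close> twin links ends in it. What remains is the first \<open>K\<close> vertices of
  each maximal chain.\<close>

definition twin_reduced :: "nat \<Rightarrow> 'a set \<Rightarrow> 'a rel \<Rightarrow> 'a set" where
  "twin_reduced K V A = V - Range (twins V A ^^ K)"

lemma tournament_Restr: "tournament V A \<Longrightarrow> W \<subseteq> V \<Longrightarrow> tournament W (Restr A W)"
  unfolding tournament_def total_on_def asym_on_def by (auto intro: finite_subset) blast

lemma tournament_irrefl: "tournament V A \<Longrightarrow> irrefl A"
  unfolding tournament_def irrefl_def by (auto dest: asymD)

lemma twins_Restr: "(u, v) \<in> twins V A \<Longrightarrow> W \<subseteq> V \<Longrightarrow> u \<in> W \<Longrightarrow> v \<in> W \<Longrightarrow> (u, v) \<in> twins W (Restr A W)"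
  unfolding twins_def by auto

text \<open>The in-neighbourhood grows by \<open>u\<close> itself. In-degree thus increases along
  chains and serves to find their ends.\<close>

lemma twins_indegree_less:
  assumes "tournament V A" "(u, v) \<in> twins V A"
  shows "card {w. (w, u) \<in> A} < card {w. (w, v) \<in> A}"
proof (rule psubset_card_mono)
  have A: "A \<subseteq> V \<times> V" "finite V" "(u, u) \<notin> A"
    using assms(1) by (auto simp: tournament_def dest: asymD)
  then show "finite {w. (w, v) \<in> A}"
    by (auto intro: finite_subset[of _ V])
  have "u \<in> V" and *: "\<And>w. w \<in> V \<Longrightarrow> (w, v) \<in> A \<longleftrightarrow> (w, u) \<in> A \<or> w = u"
    using assms(2) by (auto simp: twins_def)
  then show "{w. (w, u) \<in> A} \<subset> {w. (w, v) \<in> A}"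
    using A by blast
qed

text \<open>The surplus vertices are deleted one by one, always one of maximal in-degree, which is
  the last remaining vertex of its chain. The set \<open>W\<close> of remaining vertices stays
  closed under twin predecessors, so the \<open>K\<close> vertices before the deleted one are still
  present and \<open>solvable_delete_last\<close> applies.\<close>

lemma solvable_restrict_to_twin_reduced:
  assumes T: "tournament V A" and K: "K > 0" "K = k * p" and C: "\<And>n. C n \<Longrightarrow> n \<le> p"
  shows "solvable C (twin_reduced K V A) (Restr A (twin_reduced K V A)) k \<longleftrightarrow> solvable C V A k"
proof -
  let ?S = "twin_reduced K V A" and ?sol = "\<lambda>W. solvable C W (Restr A W) k"
  have S: "?S \<subseteq> V" by (auto simp: twin_reduced_def)
  have finV: "finite V" and AV: "A \<subseteq> V \<times> V" using T by (auto simp: tournament_def)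
  have "?sol ?S \<longleftrightarrow> ?sol W"
    if "?S \<subseteq> W" "W \<subseteq> V" "\<And>u v. (u, v) \<in> twins V A \<Longrightarrow> v \<in> W \<Longrightarrow> u \<in> W" for W
    using that
  proof (induction "card (W - ?S)" arbitrary: W)
    case 0
    have "finite (W - ?S)" using 0 finV finite_subset by blast
    then have "W = ?S" using 0 by auto
    then show ?case by simp
  next
    case (Suc d)
    define ind where "ind v = card {w. (w, v) \<in> A}" for v
    have fin: "finite (W - ?S)" using Suc.prems finV finite_subset by blast
    have "W - ?S \<noteq> {}" using Suc.hyps(2) by (metis card.empty nat.distinct(1))
    then obtain v where v: "v \<in> W - ?S" "\<And>w. w \<in> W - ?S \<Longrightarrow> ind w \<le> ind v"
      using obtains_MAX[OF fin, of ind] by (metis (no_types, lifting) Max_ge fin finite_imageI imageI)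
    have "v \<in> Range (twins V A ^^ K)"
      using v Suc.prems(2) by (auto simp: twin_reduced_def)
    then obtain c where c: "c K = v" "\<And>i. i < K \<Longrightarrow> (c i, c (Suc i)) \<in> twins V A"
      by (auto simp: relpow_fun_conv)
    have cW: "c (K - i) \<in> W" for i
    proof (induction i)
      case 0
      then show ?case using v c by simp
    next
      case (Suc i)
      show ?case
      proof (cases "i < K")
        case True
        then have "(c (K - Suc i), c (K - i)) \<in> twins V A"
          using c(2)[of "K - Suc i"] by (simp add: Suc_diff_Suc)
        then show ?thesis using Suc.IH \<open>\<And>u v. (u, v) \<in> twins V A \<Longrightarrow> v \<in> W \<Longrightarrow> u \<in> W\<close> by blast
      qed (use Suc.IH in simp)
    qed
    have cW: "c i \<in> W" if "i \<le> K" for i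
      using cW[of "K - i"] that by simp
    interpret ch: twin_chain W "Restr A W" c K
      by unfold_locales
        (use c cW Suc.prems in \<open>auto intro!: tournament_Restr[OF T] twins_Restr simp del: twins_def\<close>)
    have "?sol ?S \<longleftrightarrow> ?sol (W - {v})"
    proof (rule Suc.hyps(1))
      show "d = card (W - {v} - ?S)"
      proof -
        have "W - {v} - ?S = (W - ?S) - {v}" by auto
        then show ?thesis using Suc.hyps(2) v(1) fin by simp
      qed
      show "?S \<subseteq> W - {v}" using Suc.prems v by auto
      show "W - {v} \<subseteq> V" using Suc.prems by auto
      fix x y assume xy: "(x, y) \<in> twins V A" "y \<in> W - {v}"
      have "x \<noteq> v"
      proof
        assume "x = v"
        then have "ind v < ind y"
          using twins_indegree_less[OF T xy(1)] by (simp add: ind_def)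
        moreover have "y \<in> Range (twins V A ^^ K)"
        proof -
          \<comment> \<open>Shifting the chain by one link makes it end in \<open>y\<close>. So the
            successor \<open>y\<close> of \<open>v\<close> is also surplus, and its in-degree is
            larger than the maximum.\<close>
          define c' where "c' i = (if i < K then c (Suc i) else y)" for i
          have "c' K = y" by (simp add: c'_def)
          moreover have "(c' i, c' (Suc i)) \<in> twins V A" if "i < K" for i
          proof (cases "Suc i < K")
            case True
            then show ?thesis using c(2)[of "Suc i"] by (simp add: c'_def)
          next
            case False
            then have "Suc i = K" using that by simp
            then show ?thesis using that c(1) xy(1) \<open>x = v\<close> by (auto simp: c'_def)
          qed
          ultimately show ?thesis by (auto simp: relpow_fun_conv Range_iff)
        qed
        then have "y \<in> W - ?S" using xy by (simp add: twin_reduced_def)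
        ultimately show False using v(2) by fastforce
      qed
      then show "x \<in> W - {v}" using xy Suc.prems(3) by blast
    qed
    also have "\<dots> \<longleftrightarrow> ?sol W"
    proof -
      have "Restr (Restr A W) (W - {v}) = Restr A (W - {v})" by auto
      then show ?thesis using ch.solvable_delete_last[OF K C] by (simp add: c(1))
    qed
    finally show ?case .
  qed
  from this[of V] have "?sol ?S \<longleftrightarrow> ?sol V"
    using S by (auto simp: twins_def)
  also have "Restr A V = A" using AV by auto
  finally show ?thesis .
qed

section \<open>Counting the kept vertices along the final acyclic order\<close>

lemma acyclic_tournament_rank:
  assumes T: "tournament V F" and "acyclic F"
  obtains r :: "'a \<Rightarrow> nat" where "bij_betw r V {..<card V}"
    and "\<And>u v. u \<in> V \<Longrightarrow> v \<in> V \<Longrightarrow> (u, v) \<in> F \<longleftrightarrow> r u < r v"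
proof
  \<comment> \<open>The rank counts the vertices from which \<open>v\<close> can be reached.
    Acyclicity excludes \<open>v\<close> itself, which makes ranks strictly increasing along arcs
    and smaller than \<open>card V\<close>; totality makes them distinct.\<close>
  define r where "r v = card {w \<in> V. (w, v) \<in> F\<^sup>+}" for v
  have fin: "finite V" and FV: "F \<subseteq> V \<times> V" and tot: "total_on V F"
    using T by (auto simp: tournament_def)
  have less: "r u < r v" if "u \<in> V" "v \<in> V" "(u, v) \<in> F" for u v
    unfolding r_def
  proof (rule psubset_card_mono)
    have "(u, u) \<notin> F\<^sup>+" using \<open>acyclic F\<close> by (simp add: acyclic_def)
    moreover have "(u, v) \<in> F\<^sup>+" using that by auto
    ultimately show "{w \<in> V. (w, u) \<in> F\<^sup>+} \<subset> {w \<in> V. (w, v) \<in> F\<^sup>+}"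
      using that by (auto intro: trancl_trans)
  qed (use fin in simp)
  show iff: "(u, v) \<in> F \<longleftrightarrow> r u < r v" if "u \<in> V" "v \<in> V" for u v
    using that less tot unfolding total_on_def by (metis less_asym less_irrefl)
  have "inj_on r V"
    using iff tot unfolding total_on_def inj_on_def by (metis less_irrefl)
  moreover have "r ` V \<subseteq> {..<card V}"
  proof clarsimp
    fix v assume "v \<in> V"
    then have "{w \<in> V. (w, v) \<in> F\<^sup>+} \<subset> V"
      using \<open>acyclic F\<close> by (auto simp: acyclic_def)
    then show "r v < card V" unfolding r_def by (rule psubset_card_mono[OF fin])
  qed
  ultimately show "bij_betw r V {..<card V}"
    unfolding bij_betw_def by (simp add: card_subset_eq card_image)
qed

text \<open>A kept untouched vertex has rank below \<open>K\<close> or comes at most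
  \<open>K\<close> positions after a touched vertex; otherwise it and the \<open>K\<close> vertices
  before it are untouched and form a chain that ends in it. Pairs of a distance and a touched vertex
  number at most \<open>K * K\<close>, and the touched vertices themselves add at most
  \<open>K\<close>.\<close>

lemma card_twin_reduced_le:
  assumes T: "tournament V A" and sol: "solvable C V A k" and C: "\<And>n. C n \<Longrightarrow> n \<le> p"
    and K: "K = k * p"
  shows "card (twin_reduced K V A) \<le> K * (K + 2)"
proof -
  obtain Xs where Xs: "decycling_family V A Xs" "length Xs \<le> k" "\<forall>X\<in>set Xs. C (card X)"
    using sol by (auto simp: solvable_def)
  let ?U = "\<Union> (set Xs)" and ?F = "fold invert Xs A" and ?S = "twin_reduced K V A"
  have "?U \<subseteq> V" using Xs(1) by (auto simp: decycling_family_def)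
  have finV: "finite V" using T by (auto simp: tournament_def)
  then have "finite ?U" using finite_subset[OF \<open>?U \<subseteq> V\<close>] by simp
  have "card ?U \<le> K"
    using card_Union_le_length_mult[of Xs k p] Xs C K by simp
  obtain r where r: "bij_betw r V {..<card V}"
    and F: "\<And>u v. u \<in> V \<Longrightarrow> v \<in> V \<Longrightarrow> (u, v) \<in> ?F \<longleftrightarrow> r u < r v"
    by (rule acyclic_tournament_rank[OF tournament_fold_invert[OF T], of Xs])
      (use Xs(1) in \<open>auto simp: decycling_family_def\<close>)
  define e where "e = inv_into V r"
  have e: "e i \<in> V" "r (e i) = i" if "i < card V" for i
    using r that unfolding e_def bij_betw_def by (metis inv_into_into f_inv_into_f lessThan_iff)+
  have er: "e (r v) = v" "r v < card V" if "v \<in> V" for v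
    using r that unfolding e_def bij_betw_def by auto
  \<comment> \<open>Arcs at untouched vertices are the same in \<open>A\<close> and in
    \<open>?F\<close>, where the in-neighbours are the vertices of smaller rank.\<close>
  have tw: "(e i, e (Suc i)) \<in> twins V A"
    if i: "Suc i < card V" and "e i \<notin> ?U" "e (Suc i) \<notin> ?U" for i
  proof -
    have "(w, e (Suc i)) \<in> A \<longleftrightarrow> (w, e i) \<in> A \<or> w = e i" if w: "w \<in> V" for w
    proof -
      have "(w, e (Suc i)) \<in> A \<longleftrightarrow> r w < Suc i"
        using F[OF w e(1)[OF i]] e(2)[OF i] \<open>e (Suc i) \<notin> ?U\<close>
        by (simp add: in_fold_invert_untouched)
      moreover have "(w, e i) \<in> A \<longleftrightarrow> r w < i"
        using F[OF w e(1)[of i]] e(2)[of i] \<open>e i \<notin> ?U\<close> i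
        by (simp add: in_fold_invert_untouched)
      moreover have "w = e i \<longleftrightarrow> r w = i"
        using er[OF w] e(2)[of i] i by auto
      ultimately show ?thesis by auto
    qed
    then show ?thesis using e(1)[of i] e(1)[OF i] i by (simp add: twins_def)
  qed
  have sub: "r ` (?S - ?U) \<subseteq> {..<K} \<union> (\<lambda>(d, x). d + r x) ` ({1..K} \<times> ?U)"
  proof (rule image_subsetI)
    fix v assume v: "v \<in> ?S - ?U"
    then have V: "v \<in> V" by (auto simp: twin_reduced_def)
    show "r v \<in> {..<K} \<union> (\<lambda>(d, x). d + r x) ` ({1..K} \<times> ?U)"
    proof (rule ccontr)
      assume neg: "\<not> ?thesis"
      then have "K \<le> r v" by auto
      have untouched: "e (r v - d) \<notin> ?U" if "d \<le> K" for d
      proof (cases "d = 0")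
        case True
        then show ?thesis using v er[OF V] by auto
      next
        case False
        have "r (e (r v - d)) = r v - d"
          using er(2)[OF V] by (intro e(2)) simp
        then have "d + r (e (r v - d)) = r v" using that \<open>K \<le> r v\<close> by simp
        moreover have "d \<in> {1..K}" using False that by simp
        ultimately have "r v \<in> (\<lambda>(d, x). d + r x) ` ({1..K} \<times> ?U)" if "e (r v - d) \<in> ?U"
          using that by (intro image_eqI[of _ _ "(d, e (r v - d))"]) auto
        then show ?thesis using neg by blast
      qed
      have "(e (r v - K + i), e (r v - K + Suc i)) \<in> twins V A" if "i < K" for i
      proof -
        have "r v - (K - i) = r v - K + i" "r v - (K - Suc i) = Suc (r v - K + i)"
          using that \<open>K \<le> r v\<close> by auto
        then show ?thesis
          using tw[of "r v - K + i"] untouched[of "K - i"] untouched[of "K - Suc i"]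
            er(2)[OF V] by simp
      qed
      then have "(e (r v - K), e (r v)) \<in> twins V A ^^ K"
        using \<open>K \<le> r v\<close> unfolding relpow_fun_conv
        by (intro exI[of _ "\<lambda>i. e (r v - K + i)"]) auto
      then show False using v er(1)[OF V] by (auto simp: twin_reduced_def)
    qed
  qed
  have fin: "finite ({1..K} \<times> ?U)" using \<open>finite ?U\<close> by simp
  have "card (?S - ?U) = card (r ` (?S - ?U))"
    by (rule card_image[symmetric], rule inj_on_subset[of r V])
      (use r in \<open>auto simp: bij_betw_def twin_reduced_def\<close>)
  also have "\<dots> \<le> card ({..<K} \<union> (\<lambda>(d, x). d + r x) ` ({1..K} \<times> ?U))"
    by (rule card_mono[OF _ sub]) (use fin in blast)
  also have "\<dots> \<le> card {..<K} + card ((\<lambda>(d, x). d + r x) ` ({1..K} \<times> ?U))"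
    by (rule card_Un_le)
  also have "\<dots> \<le> K + card ({1..K} \<times> ?U)"
    using card_image_le[OF fin] by simp
  also have "\<dots> \<le> K + K * K"
    using \<open>card ?U \<le> K\<close> by (simp add: card_cartesian_product)
  finally have "card (?S - ?U) \<le> K + K * K" .
  moreover have "card ?S \<le> card (?S - ?U) + card ?U"
  proof -
    have "card ?S \<le> card ((?S - ?U) \<union> ?U)"
      using finV \<open>finite ?U\<close> by (intro card_mono) (auto simp: twin_reduced_def)
    then show ?thesis using card_Un_le[of "?S - ?U" ?U] by linarith
  qed
  ultimately show ?thesis using \<open>card ?U \<le> K\<close> by (simp add: algebra_simps)
qed

text \<open>
  Each triple \<open>{3 * i, 3 * i + 1, 3 * i + 2}\<close> is a directed triangle, and at least two of its vertices must
  be touched.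
\<close>

definition reversed_path :: "nat \<Rightarrow> nat rel" where
  "reversed_path n = {(i, j). i < n \<and> j < n \<and> (i = Suc j \<or> Suc i < j)}"

lemma tournament_reversed_path: "tournament {..<n} (reversed_path n)"
  by (auto simp: tournament_def reversed_path_def asym_on_def total_on_def)

text \<open>The \<open>K\<close> disjoint triples would need \<open>2 * K\<close> touched vertices,
  but only \<open>K\<close> are available.\<close>

lemma not_solvable_reversed_path:
  assumes C: "\<And>n. C n \<Longrightarrow> n \<le> p" and "k * p = K" "K > 0"
  shows "\<not> solvable C {..<3 * K} (reversed_path (3 * K)) k"
proof
  let ?A = "reversed_path (3 * K)"
  assume "solvable C {..<3 * K} ?A k"
  then obtain Xs where Xs: "set Xs \<subseteq> Pow {..<3 * K}" "acyclic (fold invert Xs ?A)"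
      "length Xs \<le> k" "\<forall>X\<in>set Xs. C (card X)"
    by (auto simp: solvable_def decycling_family_def)
  let ?U = "\<Union> (set Xs)" and ?F = "fold invert Xs ?A"
  have "card ?U \<le> K"
    using card_Union_le_length_mult[of Xs k p] Xs C assms(2) by simp
  have fin: "finite ?U" using Xs(1) finite_subset[of ?U "{..<3 * K}"] by auto
  have two: "2 \<le> card (?U \<inter> {3 * i..<3 * Suc i})" if i: "i < K" for i
  proof (rule ccontr)
    let ?D = "?U \<inter> {3 * i..<3 * Suc i}"
    assume "\<not> 2 \<le> card ?D"
    then have "card ?D \<le> Suc 0" by simp
    moreover have "finite ?D" by simp
    ultimately have one: "x = y" if "x \<in> ?D" "y \<in> ?D" for x y
      using that card_le_Suc0_iff_eq by blast
    \<comment> \<open>With at most one touched vertex in the triple, each of its arcs has an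
      untouched end and survives.\<close>
    have arc: "(x, y) \<in> ?F" if "(x, y) \<in> ?A" "x \<noteq> y" "x \<in> {3 * i..<3 * Suc i}" "y \<in> {3 * i..<3 * Suc i}" for x y
    proof -
      have "x \<notin> ?U \<or> y \<notin> ?U" using one[of x y] that by blast
      then show ?thesis using in_fold_invert_untouched that(1) by metis
    qed
    have "(3 * i, 3 * i + 2) \<in> ?F" "(3 * i + 2, 3 * i + 1) \<in> ?F" "(3 * i + 1, 3 * i) \<in> ?F"
      by (rule arc; use i in \<open>simp add: reversed_path_def\<close>)+
    then have "(3 * i, 3 * i) \<in> ?F\<^sup>+"
      by (meson trancl.r_into_trancl trancl.trancl_into_trancl)
    then show False using Xs(2) by (simp add: acyclic_def)
  qed
  have "2 * m \<le> card (?U \<inter> {..<3 * m})" if "m \<le> K" for m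
    using that
  proof (induction m)
    case (Suc m)
    have "?U \<inter> {..<3 * Suc m} = (?U \<inter> {..<3 * m}) \<union> (?U \<inter> {3 * m..<3 * Suc m})"
      by auto
    moreover have "card \<dots> = card (?U \<inter> {..<3 * m}) + card (?U \<inter> {3 * m..<3 * Suc m})"
      by (rule card_Un_disjoint) auto
    ultimately show ?case using Suc two[of m] by simp
  qed simp
  from this[of K] have "2 * K \<le> card ?U"
    using card_mono[OF fin, of "?U \<inter> {..<3 * K}"] by simp
  then show False using \<open>card ?U \<le> K\<close> \<open>K > 0\<close> by simp
qed

section \<open>Verification of timed programs\<close>

text \<open>Total correctness within a budget: \<open>exec\<close> counts steps exactly, while
  \<open>T\<close> is an upper bound that can be rounded up.\<close>

definition runs :: "com \<Rightarrow> state \<Rightarrow> nat \<Rightarrow> (state \<Rightarrow> bool) \<Rightarrow> bool" where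
  "runs c s T Q \<longleftrightarrow> (\<exists>t s'. exec c s t s' \<and> t \<le> T \<and> Q s')"

inductive_simps exec_Skip_iff: "exec Skip s t s'"
inductive_simps exec_Assign_iff: "exec (Assign x i e) s t s'"
inductive_simps exec_Seq_iff: "exec (Seq c1 c2) s t s'"
inductive_simps exec_If_iff: "exec (If b c1 c2) s t s'"

section \<open>Symbolic execution of loop-free code by rewriting; \<open>0 < T\<close> guards the
  truncated \<open>T - 1\<close>\<close>

lemma runs_Skip [simp]: "runs Skip s T Q \<longleftrightarrow> 0 < T \<and> Q s"
  by (auto simp: runs_def exec_Skip_iff)

lemma runs_Assign [simp]:
  "runs (Assign x i e) s T Q \<longleftrightarrow> 0 < T \<and> Q (s(x := (s x)(aval i s := aval e s)))"
  by (auto simp: runs_def exec_Assign_iff)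

lemma runs_If [simp]:
  "runs (If b c1 c2) s T Q \<longleftrightarrow> 0 < T \<and> runs (if bval b s then c1 else c2) s (T - 1) Q"
  by (force simp: runs_def exec_If_iff)

lemma runs_Seq_Assign [simp]:
  "runs (Seq (Assign x i e) c) s T Q \<longleftrightarrow>
     0 < T \<and> runs c (s(x := (s x)(aval i s := aval e s))) (T - 1) Q"
  by (force simp: runs_def exec_Assign_iff exec_Seq_iff)

lemma runs_Seq_If [simp]:
  "runs (Seq (If b c1 c2) c) s T Q \<longleftrightarrow>
     0 < T \<and> runs (Seq (if bval b s then c1 else c2) c) s (T - 1) Q"
  by (force simp: runs_def exec_If_iff exec_Seq_iff)

lemma runs_Seq_Skip [simp]: "runs (Seq Skip c) s T Q \<longleftrightarrow> 0 < T \<and> runs c s (T - 1) Q"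
  by (force simp: runs_def exec_Skip_iff exec_Seq_iff)

lemma runs_Seq_assoc [simp]: "runs (Seq (Seq c1 c2) c3) s T Q \<longleftrightarrow> runs (Seq c1 (Seq c2 c3)) s T Q"
proof -
  have "exec (Seq (Seq c1 c2) c3) s t s' \<longleftrightarrow> exec (Seq c1 (Seq c2 c3)) s t s'" for t s'
    unfolding exec_Seq_iff by (metis add.assoc)
  then show ?thesis by (simp add: runs_def)
qed

lemma runs_Seq:
  assumes "runs c1 s T1 P" "\<And>s'. P s' \<Longrightarrow> runs c2 s' T2 Q" "T1 + T2 \<le> T"
  shows "runs (Seq c1 c2) s T Q"
proof -
  obtain t1 s1 where 1: "exec c1 s t1 s1" "t1 \<le> T1" "P s1"
    using assms(1) by (auto simp: runs_def)
  obtain t2 s2 where 2: "exec c2 s1 t2 s2" "t2 \<le> T2" "Q s2"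
    using assms(2)[OF 1(3)] by (auto simp: runs_def)
  show ?thesis
    unfolding runs_def using exec.Seq[OF 1(1) 2(1)] 1(2) 2(2,3) assms(3)
    by (intro exI[of _ "t1 + t2"] exI[of _ s2]) simp
qed

lemma runs_mono:
  assumes "runs c s T P" "T \<le> T'" "\<And>s'. P s' \<Longrightarrow> Q s'"
  shows "runs c s T' Q"
  using assms unfolding runs_def by (meson order_trans)

abbreviation Var :: "vname \<Rightarrow> aexp" where
  "Var x \<equiv> Cell x (N 0)"

abbreviation Set :: "vname \<Rightarrow> aexp \<Rightarrow> com" where
  "Set x e \<equiv> Assign x (N 0) e"

definition For :: "vname \<Rightarrow> aexp \<Rightarrow> com \<Rightarrow> com" where
  "For x e c = Seq (Set x (N 0)) (While (Less (Var x) e) (Seq c (Set x (Plus (Var x) (N 1)))))"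

text \<open>A round costs the body plus 2 for the test and the increment; the other 2 steps are the
  initialization and the failing last test. The bound \<open>e\<close> is evaluated anew in each
  round, so the invariant must fix its value. The body must preserve the counter, and
  \<open>I (Suc i)\<close> refers to the state after the increment.\<close>

lemma runs_For:
  assumes init: "I 0 (s(x := (s x)(0 := 0)))"
    and bound: "\<And>i s. I i s \<Longrightarrow> aval e s = m"
    and step: "\<And>i s. i < m \<Longrightarrow> I i s \<Longrightarrow> s x 0 = i \<Longrightarrow>
      runs c s T (\<lambda>s'. s' x 0 = i \<and> I (Suc i) (s'(x := (s' x)(0 := Suc i))))"
    and fin: "\<And>s. I m s \<Longrightarrow> Q s"
    and T': "m * (T + 2) + 2 \<le> T'"
  shows "runs (For x e c) s T' Q"
proof -
  let ?w = "While (Less (Var x) e) (Seq c (Set x (Plus (Var x) (N 1))))"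
  \<comment> \<open>Induction on the number \<open>d\<close> of rounds still to come.\<close>
  have "runs ?w s (d * (T + 2) + 1) Q" if "I (m - d) s" "s x 0 = m - d" "d \<le> m" for d s
    using that
  proof (induction d arbitrary: s)
    case 0
    then have "\<not> bval (Less (Var x) e) s" using bound by simp
    from exec.WhileFalse[OF this] show ?case
      unfolding runs_def using 0 fin by (intro exI[of _ 1] exI[of _ s]) simp
  next
    case (Suc d)
    let ?i = "m - Suc d"
    have b: "bval (Less (Var x) e) s" using bound Suc.prems by simp
    have i: "?i < m" "Suc ?i = m - d" using Suc.prems(3) by auto
    obtain t1 s1 where 1: "exec c s t1 s1" "t1 \<le> T" "s1 x 0 = ?i"
        "I (Suc ?i) (s1(x := (s1 x)(0 := Suc ?i)))"
      using step[OF i(1) Suc.prems(1,2)] by (auto simp: runs_def)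
    let ?s2 = "s1(x := (s1 x)(0 := Suc ?i))"
    have "exec (Set x (Plus (Var x) (N 1))) s1 1 ?s2"
      using 1(3) by (simp add: exec_Assign_iff)
    then have 2: "exec (Seq c (Set x (Plus (Var x) (N 1)))) s (t1 + 1) ?s2"
      using 1(1) by (rule exec.Seq[rotated])
    have "runs ?w ?s2 (d * (T + 2) + 1) Q"
    proof (rule Suc.IH)
      show "I (m - d) ?s2" using 1(4) by (simp only: i(2))
    qed (use i(2) Suc.prems(3) in simp_all)
    then obtain t2 s3 where 3: "exec ?w ?s2 t2 s3" "t2 \<le> d * (T + 2) + 1" "Q s3"
      by (auto simp: runs_def)
    show ?case
      unfolding runs_def using exec.WhileTrue[OF b 2 3(1)] 1(2) 3(2,3)
      by (intro exI[of _ "t1 + 1 + t2 + 1"] exI[of _ s3]) simp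
  qed
  from this[of m "s(x := (s x)(0 := 0))"]
  have "runs ?w (s(x := (s x)(0 := 0))) (m * (T + 2) + 1) Q"
    using init by simp
  then have "runs ?w (s(x := (s x)(0 := 0))) (T' - 1) Q"
    using T' by (elim runs_mono) auto
  then show ?thesis
    using T' by (simp add: For_def)
qed

text \<open>The frame condition that carries the input and earlier results past a program part using
  only the arrays in \<open>X\<close>.\<close>

definition same_outside :: "vname set \<Rightarrow> state \<Rightarrow> state \<Rightarrow> bool" where
  "same_outside X s s' \<longleftrightarrow> (\<forall>y. y \<notin> X \<longrightarrow> s' y = s y)"

lemma same_outside_refl [simp]: "same_outside X s s"
  by (simp add: same_outside_def)

lemma same_outside_upd [simp]:
  "x \<in> X \<Longrightarrow> same_outside X s (s'(x := a)) \<longleftrightarrow> same_outside X s s'"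
  by (auto simp: same_outside_def)

lemma same_outside_trans:
  "same_outside X s s' \<Longrightarrow> same_outside Y s' s'' \<Longrightarrow> X \<union> Y \<subseteq> Z \<Longrightarrow> same_outside Z s s''"
  by (simp add: same_outside_def subset_iff) metis

section \<open>The kernelization program\<close>

abbreviation "vn \<equiv> Cell ''in'' (N 0)"
abbreviation "vp \<equiv> Cell ''in'' (N 1)"
abbreviation "vk \<equiv> Cell ''in'' (N 2)"

text \<open>
  \<open>K\<close> is truncated at the number of vertices, since \<open>p\<close> and \<open>k\<close> may be exponential in the input size.
\<close>

definition prog_K :: com where
  "prog_K = Seq (If (Eq vp (N 1)) (Set ''q'' (N 1)) (Set ''q'' vk))
    (Seq (Set ''K'' (N 0))
    (Seq (For ''i'' vn (If (Less (Var ''i'') (Var ''q'')) (Set ''K'' (Plus (Var ''K'') vp)) Skip))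
    (If (Less vn (Var ''K'')) (Set ''K'' vn) Skip)))"

text \<open>At most \<open>n\<close> additions of \<open>p\<close> suffice for the truncated
  product: since \<open>p\<close> is positive, \<open>n\<close> of them already reach
  \<open>n\<close>.\<close>

lemma min_mult_min:
  fixes n p q :: nat
  assumes "1 \<le> p"
  shows "min n (p * min n q) = min n (q * p)"
proof (cases "n \<le> q")
  case True
  moreover have "n * 1 \<le> p * n" "n * 1 \<le> q * p"
    using assms True by (simp, intro mult_le_mono) auto
  ultimately show ?thesis by (simp add: min_def)
qed (simp add: min_def mult.commute)

lemma runs_prog_K:
  assumes "s ''in'' 0 = n" "s ''in'' 1 = p" "s ''in'' 2 = k" "1 \<le> p"
  shows "runs prog_K s (10 * n + 10)
    (\<lambda>s'. s' ''K'' 0 = min n ((if p = 1 then 1 else k) * p) \<and> same_outside {''q'', ''K'', ''i''} s s')"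
proof -
  define q where "q = (if p = 1 then 1 else k)"
  have in1: "s ''in'' (Suc 0) = p" using assms(2) by simp
  define s1 where "s1 = s(''q'' := (s ''q'')(0 := q), ''K'' := (s ''K'')(0 := 0))"
  have "runs (Seq (For ''i'' vn (If (Less (Var ''i'') (Var ''q'')) (Set ''K'' (Plus (Var ''K'') vp)) Skip))
    (If (Less vn (Var ''K'')) (Set ''K'' vn) Skip)) s1 (7 + 10 * n)
    (\<lambda>s'. s' ''K'' 0 = min n (q * p) \<and> same_outside {''q'', ''K'', ''i''} s s')" 
  proof (rule runs_Seq)
    show "runs (For ''i'' vn (If (Less (Var ''i'') (Var ''q'')) (Set ''K'' (Plus (Var ''K'') vp)) Skip)) s1 (10 * n + 3)
      (\<lambda>s'. s' ''K'' 0 = p * min n q \<and> same_outside {''q'', ''K'', ''i''} s s')"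
    proof (rule runs_For[where I = "\<lambda>i s'. s' ''q'' 0 = q \<and> s' ''K'' 0 = p * min i q 
        \<and> same_outside {''q'', ''K'', ''i''} s s'" and m = n and T = 2])
      fix i s' assume "i < n" 
        and *: "s' ''q'' 0 = q \<and> s' ''K'' 0 = p * min i q \<and> same_outside {''q'', ''K'', ''i''} s s'"
        "s' ''i'' 0 = i"
      have "s' ''in'' = s ''in''" using * by (simp add: same_outside_def)
      with * in1 show "runs (If (Less (Var ''i'') (Var ''q'')) (Set ''K'' (Plus (Var ''K'') vp)) Skip) s' 2
         (\<lambda>s'a. s'a ''i'' 0 = i \<and> (s'a(''i'' := (s'a ''i'')(0 := Suc i))) ''q'' 0 = q \<and>
          (s'a(''i'' := (s'a ''i'')(0 := Suc i))) ''K'' 0 = p * min (Suc i) q \<and>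
          same_outside {''q'', ''K'', ''i''} s (s'a(''i'' := (s'a ''i'')(0 := Suc i))))"
        by (simp add: min_def)
    qed (simp_all add: s1_def assms same_outside_def)
    show "runs (If (Less vn (Var ''K'')) (Set ''K'' vn) Skip) s' 2
      (\<lambda>s'. s' ''K'' 0 = min n (q * p) \<and> same_outside {''q'', ''K'', ''i''} s s')"
      if "s' ''K'' 0 = p * min n q \<and> same_outside {''q'', ''K'', ''i''} s s'" for s'
    proof -
      have "s' ''in'' = s ''in''" using that by (simp add: same_outside_def)
      then show ?thesis
        using that assms(1) unfolding min_mult_min[OF assms(4), of n q, symmetric]
        by (auto simp: min_def)
    qed
  qed simp
  then show ?thesis
    using in1 assms(3) by (cases "p = 1") (simp_all add: prog_K_def s1_def q_def)
qed


text \<open>The threshold for the number of kept vertices, by repeated addition because the machine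
  has no multiplication.\<close>

definition prog_B :: com where
  "prog_B = Seq (Set ''B'' (N 0))
     (For ''i'' (Var ''K'') (Set ''B'' (Plus (Var ''B'') (Plus (Var ''K'') (N 2)))))"

lemma runs_prog_B:
  assumes "s ''K'' 0 = K"
  shows "runs prog_B s (10 * K + 10) (\<lambda>s'. s' ''B'' 0 = K * (K + 2) \<and> same_outside {''B'', ''i''} s s')"
  unfolding prog_B_def runs_Seq_Assign
proof (intro conjI, goal_cases)
  case 2
  show ?case
  proof (rule runs_For[where I = "\<lambda>i s'. s' ''B'' 0 = i * (K + 2) \<and> same_outside {''B'', ''i''} s s'"
        and m = K and T = 1])
    fix i s' assume "s' ''B'' 0 = i * (K + 2) \<and> same_outside {''B'', ''i''} s s'"
    moreover from this have "s' ''K'' = s ''K''" by (simp add: same_outside_def)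
    ultimately show "aval (Var ''K'') s' = K"
      "s' ''i'' 0 = i \<Longrightarrow> runs (Set ''B'' (Plus (Var ''B'') (Plus (Var ''K'') (N 2)))) s' 1 (\<lambda>s'.
         s' ''i'' 0 = i \<and> (s'(''i'' := (s' ''i'')(0 := Suc i))) ''B'' 0 = Suc i * (K + 2) \<and> 
         same_outside {''B'', ''i''} s (s'(''i'' := (s' ''i'')(0 := Suc i))))"
      using assms by simp_all
  qed simp_all
qed simp

text \<open>Tabulates where the rows of the adjacency matrix start, again to avoid multiplication;
  the offset 3 skips \<open>n\<close>, \<open>p\<close> and \<open>k\<close>.\<close>

definition prog_R :: com where
  "prog_R = Seq (Set ''x'' (N 3))
     (For ''i'' vn (Seq (Assign ''R'' (Var ''i'') (Var ''x'')) (Set ''x'' (Plus (Var ''x'') vn))))"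

lemma runs_prog_R:
  assumes "s ''in'' 0 = n"
  shows "runs prog_R s (10 * n + 10)
    (\<lambda>s'. (\<forall>i<n. s' ''R'' i = 3 + i * n) \<and> same_outside {''R'', ''x'', ''i''} s s')"
  unfolding prog_R_def runs_Seq_Assign
proof (intro conjI, goal_cases)
  case 2
  show ?case
  proof (rule runs_For[where I = "\<lambda>i s'. (\<forall>j<i. s' ''R'' j = 3 + j * n) \<and> s' ''x'' 0 = 3 + i * n \<and>
        same_outside {''R'', ''x'', ''i''} s s'" and m = n and T = 2])
    fix i s' assume "(\<forall>j<i. s' ''R'' j = 3 + j * n) \<and> s' ''x'' 0 = 3 + i * n \<and>
        same_outside {''R'', ''x'', ''i''} s s'"
    moreover from this have "s' ''in'' = s ''in''" by (simp add: same_outside_def)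
    ultimately show "aval vn s' = n"
      "s' ''i'' 0 = i \<Longrightarrow> runs (Seq (Assign ''R'' (Var ''i'') (Var ''x'')) (Set ''x'' (Plus (Var ''x'') vn))) s' 2 (\<lambda>s'.
         s' ''i'' 0 = i \<and> (\<forall>j<Suc i. (s'(''i'' := (s' ''i'')(0 := Suc i))) ''R'' j = 3 + j * n) \<and>
         (s'(''i'' := (s' ''i'')(0 := Suc i))) ''x'' 0 = 3 + Suc i * n \<and>
         same_outside {''R'', ''x'', ''i''} s (s'(''i'' := (s' ''i'')(0 := Suc i))))"
      using assms by (simp_all add: less_Suc_eq)
  qed simp_all
qed simp

section \<open>Finding the twins and the kept vertices\<close>

definition loaded :: "nat \<Rightarrow> nat rel \<Rightarrow> state \<Rightarrow> bool" where
  "loaded n A s \<longleftrightarrow> s ''in'' 0 = n \<and> (\<forall>i<n. s ''R'' i = 3 + i * n) \<and>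
     (\<forall>i<n. \<forall>j<n. s ''in'' (3 + i * n + j) = of_bool ((i, j) \<in> A))"

lemma loaded_same_outside:
  assumes "loaded n A s" "same_outside X s s'" "''in'' \<notin> X" "''R'' \<notin> X"
  shows "loaded n A s'"
proof -
  have "s' ''in'' = s ''in''" "s' ''R'' = s ''R''"
    using assms(2-4) by (simp_all add: same_outside_def)
  then show ?thesis using assms(1) by (simp add: loaded_def)
qed

text \<open>For each \<open>w\<close> the entry for \<open>(w, v)\<close> is compared with
  \<open>x\<close>, the truth value of the right-hand side in the definition of
  \<open>twins\<close>.\<close>

definition prog_check :: com where
  "prog_check = Seq (Set ''ok'' (N 1)) (For ''w'' vn
     (Seq (If (Eq (Var ''w'') (Var ''u'')) (Set ''x'' (N 1))
            (Set ''x'' (Cell ''in'' (Plus (Cell ''R'' (Var ''w'')) (Var ''u'')))))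
     (If (Eq (Var ''x'') (Cell ''in'' (Plus (Cell ''R'' (Var ''w'')) (Var ''v'')))) Skip
        (Set ''ok'' (N 0)))))"

lemma runs_prog_check:
  assumes ld: "loaded n A s" and "s ''u'' 0 = u" "u < n" "s ''v'' 0 = v" "v < n"
  shows "runs prog_check s (n * 6 + 3)
    (\<lambda>s'. s' ''ok'' 0 = of_bool ((u, v) \<in> twins {..<n} A) \<and> same_outside {''ok'', ''w'', ''x''} s s')"
proof -
  define G where "G w \<longleftrightarrow> ((w, v) \<in> A \<longleftrightarrow> (w, u) \<in> A \<or> w = u)" for w
  have tw: "(u, v) \<in> twins {..<n} A \<longleftrightarrow> (\<forall>w<n. G w)"
    using assms by (auto simp: twins_def G_def)
  show ?thesis
    unfolding prog_check_def runs_Seq_Assign tw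
  proof (intro conjI, goal_cases)
    case 2
    show ?case
    proof (rule runs_For[where I = "\<lambda>i s'. s' ''ok'' 0 = of_bool (\<forall>w<i. G w) \<and>
          same_outside {''ok'', ''w'', ''x''} s s'" and m = n and T = 4])
      fix i s' assume *: "s' ''ok'' 0 = of_bool (\<forall>w<i. G w) \<and> same_outside {''ok'', ''w'', ''x''} s s'"
      then have ld': "loaded n A s'" using loaded_same_outside[OF ld, of "{''ok'', ''w'', ''x''}"] by simp
      then show "aval vn s' = n" by (simp add: loaded_def)
      have uv: "s' ''u'' 0 = u" "s' ''v'' 0 = v" using * assms by (simp_all add: same_outside_def)
      assume i: "i < n" "s' ''w'' 0 = i"
      have "s' ''in'' (s' ''R'' i + u) = of_bool ((i, u) \<in> A)"
        "s' ''in'' (s' ''R'' i + v) = of_bool ((i, v) \<in> A)"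
        using ld' i assms by (simp_all add: loaded_def)
      moreover have "(\<forall>w<Suc i. G w) \<longleftrightarrow> (\<forall>w<i. G w) \<and> G i"
        by (auto simp: less_Suc_eq)
      ultimately show "runs (Seq (If (Eq (Var ''w'') (Var ''u'')) (Set ''x'' (N 1))
            (Set ''x'' (Cell ''in'' (Plus (Cell ''R'' (Var ''w'')) (Var ''u'')))))
          (If (Eq (Var ''x'') (Cell ''in'' (Plus (Cell ''R'' (Var ''w'')) (Var ''v'')))) Skip
          (Set ''ok'' (N 0)))) s' 4 (\<lambda>s'. s' ''w'' 0 = i \<and>
           (s'(''w'' := (s' ''w'')(0 := Suc i))) ''ok'' 0 = of_bool (\<forall>w<Suc i. G w) \<and>
           same_outside {''ok'', ''w'', ''x''} s (s'(''w'' := (s' ''w'')(0 := Suc i))))"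
        using * uv i G_def[of i] by (cases "i = u"; cases "G i") auto
    qed simp_all
  qed simp
qed

text \<open>Each of two distinct predecessors would dominate the other. Hence one array cell per
  vertex can store its predecessor.\<close>

lemma twins_unique:
  assumes "tournament V A" "(u, v) \<in> twins V A" "(u', v) \<in> twins V A"
  shows "u = u'"
proof (rule ccontr)
  assume "u \<noteq> u'"
  then have "(u', u) \<in> A" "(u, u') \<in> A"
    using assms(2,3) by (auto simp: twins_def)
  then show False using assms(1) by (auto simp: tournament_def dest: asymD)
qed

text \<open>
  Array \<open>P\<close> maps \<open>v + 1\<close> to \<open>u + 1\<close> if \<open>v\<close> is the twin successor of \<open>u\<close>; 0 stands for no vertex.
\<close>

definition prog_twins :: com where
  "prog_twins = For ''v'' vn (For ''u'' vn (Seq prog_check (If (Eq (Var ''ok'') (N 1))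
     (Assign ''P'' (Plus (Var ''v'') (N 1)) (Plus (Var ''u'') (N 1))) Skip)))"

lemma runs_prog_twins:
  assumes T: "tournament {..<n} A" and ld: "loaded n A s" and P: "s ''P'' = (\<lambda>_. 0)"
  shows "runs prog_twins s (n * (n * (n * 6 + 8) + 4) + 2)
    (\<lambda>s'. s' ''P'' 0 = 0 \<and> (\<forall>v u. s' ''P'' (Suc v) = Suc u \<longleftrightarrow> (u, v) \<in> twins {..<n} A) \<and>
      same_outside {''v'', ''u'', ''ok'', ''w'', ''x'', ''P''} s s')"
proof -
  let ?X = "{''v'', ''u'', ''ok'', ''w'', ''x'', ''P''}"
  \<comment> \<open>\<open>D\<close> is the set of pairs examined so far. By \<open>I_cong\<close>
    only its twin pairs matter, which lets the invariants of the two loops fit together.\<close>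
  define I where "I D s' \<longleftrightarrow> s' ''P'' 0 = 0 \<and>
      (\<forall>v u. s' ''P'' (Suc v) = Suc u \<longleftrightarrow> (u, v) \<in> twins {..<n} A \<and> (u, v) \<in> D) \<and> same_outside ?X s s'"
    for D s'
  have ldI: "loaded n A s'" if "I D s'" for D s'
    using loaded_same_outside[OF ld, of ?X s'] that by (simp add: I_def)
  have I_upd: "I D (s'(x := f)) \<longleftrightarrow> I D s'" if "x \<in> ?X" "x \<noteq> ''P''" for D s' x f
    using that by (simp add: I_def)
  have I_cong: "I D s' \<longleftrightarrow> I D' s'" if "twins {..<n} A \<inter> D = twins {..<n} A \<inter> D'" for D D' s'
    unfolding I_def using that by (metis IntD1 IntD2 IntI)
  have vn: "aval vn s' = n" if "I D s'" for D s'
    using ldI[OF that] by (simp add: loaded_def)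
  have inner: "runs (Seq prog_check (If (Eq (Var ''ok'') (N 1))
      (Assign ''P'' (Plus (Var ''v'') (N 1)) (Plus (Var ''u'') (N 1))) Skip)) s' (n * 6 + 6)
    (\<lambda>s''. s'' ''u'' 0 = u \<and> s'' ''v'' 0 = v \<and> I {(u', v'). v' < v \<or> v' = v \<and> u' < Suc u} s'')"
    if "u < n" "v < n" "s' ''u'' 0 = u" "s' ''v'' 0 = v"
      and Is: "I {(u', v'). v' < v \<or> v' = v \<and> u' < u} s'" for u v s'
  proof (rule runs_Seq[OF runs_prog_check[OF ldI[OF Is] that(3,1,4,2)], where ?T2.0 = 2])
    fix s'' assume *: "s'' ''ok'' 0 = of_bool ((u, v) \<in> twins {..<n} A) \<and>
      same_outside {''ok'', ''w'', ''x''} s' s''"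
    then have eq: "s'' ''u'' = s' ''u''" "s'' ''v'' = s' ''v''" "s'' ''P'' = s' ''P''"
      by (simp_all add: same_outside_def)
    have "same_outside ?X s s''"
      by (rule same_outside_trans[of ?X s s' "{''ok'', ''w'', ''x''}"])
        (use Is * in \<open>auto simp: I_def\<close>)
    with Is eq(3) have I: "I {(u', v'). v' < v \<or> v' = v \<and> u' < u} s''"
      by (simp add: I_def)
    show "runs (If (Eq (Var ''ok'') (N 1))
        (Assign ''P'' (Plus (Var ''v'') (N 1)) (Plus (Var ''u'') (N 1))) Skip) s'' 2
        (\<lambda>s''. s'' ''u'' 0 = u \<and> s'' ''v'' 0 = v \<and> I {(u', v'). v' < v \<or> v' = v \<and> u' < Suc u} s'')"
    proof (cases "(u, v) \<in> twins {..<n} A")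
      case True
      \<comment> \<open>By uniqueness, writing the cell of \<open>v\<close> loses no other
        predecessor.\<close>
      have "(u', v) \<in> twins {..<n} A \<longleftrightarrow> u' = u" for u'
        using twins_unique[OF T True, of u'] True by blast
      then have "I {(u', v'). v' < v \<or> v' = v \<and> u' < Suc u} (s''(''P'' := (s'' ''P'')(Suc v := Suc u)))"
        using I True unfolding I_def
        by (intro conjI allI; clarsimp simp: less_Suc_eq; fastforce)
      then show ?thesis using True * eq that(3,4) by simp
    next
      case False
      have "I {(u', v'). v' < v \<or> v' = v \<and> u' < Suc u} s''"
        by (rule I_cong[THEN iffD1, OF _ I]) (use False in \<open>auto simp: less_Suc_eq\<close>)
      then show ?thesis using False * eq that(3,4) by simp
    qed
  qed simp
  have "runs prog_twins s (n * (n * (n * 6 + 8) + 4) + 2) (I {(u', v'). v' < n})"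
    unfolding prog_twins_def
  proof (rule runs_For[where I = "\<lambda>v. I {(u', v'). v' < v}" and m = n and T = "n * (n * 6 + 8) + 2"])
    fix v s' assume v: "v < n" "I {(u', v'). v' < v} s'" "s' ''v'' 0 = v"
    show "runs (For ''u'' vn (Seq prog_check (If (Eq (Var ''ok'') (N 1))
        (Assign ''P'' (Plus (Var ''v'') (N 1)) (Plus (Var ''u'') (N 1))) Skip))) s'
      (n * (n * 6 + 8) + 2) (\<lambda>s'. s' ''v'' 0 = v \<and>
         I {(u', v'). v' < Suc v} (s'(''v'' := (s' ''v'')(0 := Suc v))))"
    proof (rule runs_For[where I = "\<lambda>u s'. s' ''v'' 0 = v \<and> I {(u', v'). v' < v \<or> v' = v \<and> u' < u} s'"
          and m = n and T = "n * 6 + 6"])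
      fix u s' assume "u < n" "s' ''v'' 0 = v \<and> I {(u', v'). v' < v \<or> v' = v \<and> u' < u} s'" "s' ''u'' 0 = u"
      then show "runs (Seq prog_check (If (Eq (Var ''ok'') (N 1))
          (Assign ''P'' (Plus (Var ''v'') (N 1)) (Plus (Var ''u'') (N 1))) Skip)) s' (n * 6 + 6)
         (\<lambda>s'. s' ''u'' 0 = u \<and> (s'(''u'' := (s' ''u'')(0 := Suc u))) ''v'' 0 = v \<and>
            I {(u', v'). v' < v \<or> v' = v \<and> u' < Suc u} (s'(''u'' := (s' ''u'')(0 := Suc u))))"
        using inner[of u v s'] v by (simp add: I_upd)
    next
      fix s' assume *: "s' ''v'' 0 = v \<and> I {(u', v'). v' < v \<or> v' = v \<and> u' < n} s'"
      have "I {(u', v'). v' < Suc v} s'"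
        by (rule I_cong[THEN iffD1, OF _ *[THEN conjunct2]]) (auto simp: twins_def less_Suc_eq)
      then show "s' ''v'' 0 = v \<and> I {(u', v'). v' < Suc v} (s'(''v'' := (s' ''v'')(0 := Suc v)))"
        using * by (simp add: I_upd)
    qed (use v vn in \<open>auto simp: I_upd\<close>)
  next
    fix i s' assume "I {(u', v'). v' < i} s'"
    then show "aval vn s' = n" by (rule vn)
  qed (use P in \<open>simp_all add: I_def algebra_simps\<close>)
  then show ?thesis
    by (rule runs_mono) (auto simp: I_def twins_def)
qed

text \<open>Follows \<open>K\<close> predecessor links from \<open>v\<close>. As \<open>P\<close>
  maps 0 to 0, a walk that runs out of predecessors stays at 0, so a nonzero end means that
  \<open>v\<close> is surplus.\<close>

definition prog_walk :: com where
  "prog_walk = Seq (Set ''x'' (Plus (Var ''v'') (N 1)))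
     (For ''i'' (Var ''K'') (Set ''x'' (Cell ''P'' (Var ''x''))))"

lemma runs_prog_walk:
  assumes P: "s ''P'' 0 = 0" "\<And>v u. s ''P'' (Suc v) = Suc u \<longleftrightarrow> (u, v) \<in> W"
    and "s ''K'' 0 = K" "s ''v'' 0 = v"
  shows "runs prog_walk s (K * 3 + 3)
    (\<lambda>s'. (s' ''x'' 0 = 0 \<longleftrightarrow> v \<notin> Range (W ^^ K)) \<and> same_outside {''i'', ''x''} s s')"
  unfolding prog_walk_def runs_Seq_Assign
proof (intro conjI, goal_cases)
  case 2
  show ?case
  proof (rule runs_For[where I = "\<lambda>i s'. (\<forall>u. s' ''x'' 0 = Suc u \<longleftrightarrow> (u, v) \<in> W ^^ i) \<and>
        same_outside {''i'', ''x''} s s'" and m = K and T = 1])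
    fix i s' assume *: "(\<forall>u. s' ''x'' 0 = Suc u \<longleftrightarrow> (u, v) \<in> W ^^ i) \<and> same_outside {''i'', ''x''} s s'"
    then have eq: "s' ''P'' = s ''P''" "s' ''K'' = s ''K''" by (simp_all add: same_outside_def)
    then show "aval (Var ''K'') s' = K" using assms by simp
    assume i: "s' ''i'' 0 = i"
    have "s ''P'' (s' ''x'' 0) = Suc u \<longleftrightarrow> (u, v) \<in> W ^^ Suc i" for u
    proof -
      \<comment> \<open>The walk goes backwards, so each new link is attached at the front.\<close>
      have "W ^^ Suc i = W O W ^^ i"
        by (simp add: relpow_commute)
      then have "(u, v) \<in> W ^^ Suc i \<longleftrightarrow> (\<exists>w. (u, w) \<in> W \<and> (w, v) \<in> W ^^ i)"
        by (simp only: relcomp_unfold mem_Collect_eq split)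
      also have "\<dots> \<longleftrightarrow> (\<exists>w. (u, w) \<in> W \<and> s' ''x'' 0 = Suc w)" using * by simp
      also have "\<dots> \<longleftrightarrow> s ''P'' (s' ''x'' 0) = Suc u"
        using P by (cases "s' ''x'' 0") auto
      finally show ?thesis by simp
    qed
    then show "runs (Set ''x'' (Cell ''P'' (Var ''x''))) s' 1 (\<lambda>s'. s' ''i'' 0 = i \<and>
        (\<forall>u. (s'(''i'' := (s' ''i'')(0 := Suc i))) ''x'' 0 = Suc u \<longleftrightarrow> (u, v) \<in> W ^^ Suc i) \<and>
        same_outside {''i'', ''x''} s (s'(''i'' := (s' ''i'')(0 := Suc i))))"
      using * i eq by (simp del: relpow.simps)
  next
    fix s' assume "(\<forall>u. s' ''x'' 0 = Suc u \<longleftrightarrow> (u, v) \<in> W ^^ K) \<and> same_outside {''i'', ''x''} s s'"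
    then show "(s' ''x'' 0 = 0 \<longleftrightarrow> v \<notin> Range (W ^^ K)) \<and> same_outside {''i'', ''x''} s s'"
      by (metis Range_iff not0_implies_Suc old.nat.distinct(2))
  qed (use assms in auto)
qed simp

text \<open>\<open>idx\<close> lists the kept vertices in increasing order and \<open>m\<close>
  counts them; this list relabels the output tournament.\<close>

definition prog_idx :: com where
  "prog_idx = Seq (Set ''m'' (N 0)) (For ''v'' vn (Seq prog_walk (If (Eq (Var ''x'') (N 0))
     (Seq (Assign ''idx'' (Var ''m'') (Var ''v'')) (Set ''m'' (Plus (Var ''m'') (N 1)))) Skip)))"

lemma runs_prog_idx:
  assumes P: "s ''P'' 0 = 0" "\<And>v u. s ''P'' (Suc v) = Suc u \<longleftrightarrow> (u, v) \<in> twins {..<n} A"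
    and "s ''K'' 0 = K" "s ''in'' 0 = n"
  shows "runs prog_idx s (n * (K * 3 + 8) + 3)
    (\<lambda>s'. bij_betw (s' ''idx'') {..<s' ''m'' 0} (twin_reduced K {..<n} A) \<and>
      same_outside {''i'', ''x'', ''m'', ''v'', ''idx''} s s')"
proof -
  let ?X = "{''i'', ''x'', ''m'', ''v'', ''idx''}" and ?S = "twin_reduced K {..<n} A"
  define I where "I v s' \<longleftrightarrow> bij_betw (s' ''idx'') {..<s' ''m'' 0} (?S \<inter> {..<v}) \<and> same_outside ?X s s'"
    for v s'
  have I_upd: "I v (s'(x := f)) \<longleftrightarrow> I v s'" if "x \<in> ?X" "x \<noteq> ''idx''" "x \<noteq> ''m''" for v s' x f
    using that by (simp add: I_def)
  show ?thesis
    unfolding prog_idx_def runs_Seq_Assign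
  proof (intro conjI, goal_cases)
    case 2
    show ?case
    proof (rule runs_For[where I = I and m = n and T = "K * 3 + 6"])
      fix v s' assume I: "I v s'"
      then have eq: "s' ''P'' = s ''P''" "s' ''K'' = s ''K''" "s' ''in'' = s ''in''"
        by (simp_all add: same_outside_def I_def)
      then show "aval vn s' = n" using assms by simp
      assume v: "v < n" "s' ''v'' 0 = v"
      show "runs (Seq prog_walk (If (Eq (Var ''x'') (N 0))
          (Seq (Assign ''idx'' (Var ''m'') (Var ''v'')) (Set ''m'' (Plus (Var ''m'') (N 1)))) Skip))
          s' (K * 3 + 6) (\<lambda>s'. s' ''v'' 0 = v \<and> I (Suc v) (s'(''v'' := (s' ''v'')(0 := Suc v))))"
      proof (rule runs_Seq[OF runs_prog_walk, where ?T2.0 = 3])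
        fix s'' assume *: "(s'' ''x'' 0 = 0 \<longleftrightarrow> v \<notin> Range (twins {..<n} A ^^ K)) \<and>
          same_outside {''i'', ''x''} s' s''"
        then have eq': "s'' ''v'' = s' ''v''" "s'' ''idx'' = s' ''idx''" "s'' ''m'' = s' ''m''"
          by (simp_all add: same_outside_def)
        have so: "same_outside ?X s s''"
          by (rule same_outside_trans[of ?X s s' "{''i'', ''x''}"]) (use I * in \<open>auto simp: I_def\<close>)
        have bij: "bij_betw (s'' ''idx'') {..<s'' ''m'' 0} (?S \<inter> {..<v})"
          using I eq' by (simp add: I_def)
        have x: "s'' ''x'' 0 = 0 \<longleftrightarrow> v \<in> ?S"
          using * v by (auto simp: twin_reduced_def)
        show "runs (If (Eq (Var ''x'') (N 0)) (Seq (Assign ''idx'' (Var ''m'') (Var ''v''))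
            (Set ''m'' (Plus (Var ''m'') (N 1)))) Skip) s'' 3
          (\<lambda>s'. s' ''v'' 0 = v \<and> I (Suc v) (s'(''v'' := (s' ''v'')(0 := Suc v))))"
        proof (cases "v \<in> ?S")
          case True
          have "bij_betw ((s'' ''idx'')(s'' ''m'' 0 := v)) {..<s'' ''m'' 0} (?S \<inter> {..<v})"
            using bij by (rule bij_betw_cong[THEN iffD1, rotated]) auto
          then have "bij_betw ((s'' ''idx'')(s'' ''m'' 0 := v)) ({..<s'' ''m'' 0} \<union> {s'' ''m'' 0}) (?S \<inter> {..<v} \<union> {v})"
            using notIn_Un_bij_betw[of "s'' ''m'' 0" "{..<s'' ''m'' 0}"
                "(s'' ''idx'')(s'' ''m'' 0 := v)" "?S \<inter> {..<v}"] by simp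
          moreover have "?S \<inter> {..<Suc v} = ?S \<inter> {..<v} \<union> {v}" using True by auto
          moreover have "{..<Suc (s'' ''m'' 0)} = {..<s'' ''m'' 0} \<union> {s'' ''m'' 0}" by auto
          ultimately show ?thesis
            using x True so v eq' by (simp add: I_def)
        next
          case False
          then have "?S \<inter> {..<Suc v} = ?S \<inter> {..<v}" by (auto simp: less_Suc_eq)
          then show ?thesis using x False so v eq' bij by (simp add: I_def)
        qed
      qed (use eq P assms v in simp_all)
    next
      fix s' assume "I n s'"
      moreover have "?S \<inter> {..<n} = ?S" by (auto simp: twin_reduced_def)
      ultimately show "bij_betw (s' ''idx'') {..<s' ''m'' 0} ?S \<and> same_outside ?X s s'"
        by (simp add: I_def)
    qed (simp_all add: I_def bij_betw_def)
  qed simp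
qed

section \<open>Writing the output instance\<close>

definition prog_cell :: com where
  "prog_cell = If (Eq (Var ''no'') (N 1))
     (If (Eq (Var ''i'') (Plus (Var ''j'') (N 1))) (Assign ''out'' (Var ''x'') (N 1))
       (If (Less (Plus (Var ''i'') (N 1)) (Var ''j'')) (Assign ''out'' (Var ''x'') (N 1))
         (Assign ''out'' (Var ''x'') (N 0))))
     (Assign ''out'' (Var ''x'')
       (Cell ''in'' (Plus (Cell ''R'' (Cell ''idx'' (Var ''i''))) (Cell ''idx'' (Var ''j'')))))"

definition prog_out :: com where
  "prog_out = Seq (Assign ''out'' (N 0) (Var ''m''))
     (Seq (Assign ''out'' (N 1) vp)
     (Seq (Assign ''out'' (N 2) vk)
     (Seq (Set ''x'' (N 3))
     (Seq (For ''i'' (Var ''m'') (For ''j'' (Var ''m'')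
        (Seq prog_cell (Set ''x'' (Plus (Var ''x'') (N 1))))))
     (Set ''outlen'' (Var ''x''))))))"

definition out_arcs :: "state \<Rightarrow> nat rel \<Rightarrow> nat rel" where
  "out_arcs s A = (if s ''no'' 0 = 1 then reversed_path (s ''m'' 0)
     else {(i, j). i < s ''m'' 0 \<and> j < s ''m'' 0 \<and> (s ''idx'' i, s ''idx'' j) \<in> A})"

lemma runs_prog_out:
  assumes ld: "loaded n A s" and m: "s ''m'' 0 = m" and pk: "s ''in'' 1 = p" "s ''in'' 2 = k"
    and idx: "s ''no'' 0 \<noteq> 1 \<Longrightarrow> s ''idx'' ` {..<m} \<subseteq> {..<n}"
  shows "runs prog_out s (m * (m * 7 + 4) + 7)
    (\<lambda>s'. s' ''out'' 0 = m \<and> s' ''out'' 1 = p \<and> s' ''out'' 2 = k \<and> s' ''outlen'' 0 = 3 + m * m \<and>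
       (\<forall>y<m * m. s' ''out'' (3 + y) = of_bool ((y div m, y mod m) \<in> out_arcs s A)))"
proof -
  let ?X = "{''out'', ''x'', ''i'', ''j''}"
  define E where "E y \<longleftrightarrow> (y div m, y mod m) \<in> out_arcs s A" for y
  \<comment> \<open>\<open>l\<close> is the number of matrix entries written so far, row by row; the
    next one belongs to row \<open>l div m\<close> and column \<open>l mod m\<close>.\<close>
  define I where "I l s' \<longleftrightarrow> s' ''out'' 0 = m \<and> s' ''out'' 1 = p \<and> s' ''out'' 2 = k \<and> s' ''x'' 0 = 3 + l \<and>
       (\<forall>y<l. s' ''out'' (3 + y) = of_bool (E y)) \<and> same_outside ?X s s'" for l s'
  have I_upd: "I l (s'(x := f)) \<longleftrightarrow> I l s'" if "x \<in> {''i'', ''j''}" for l s' x f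
    using that by (auto simp: I_def)
  have I_D: "s' ''m'' = s ''m''" "s' ''in'' = s ''in''" "s' ''R'' = s ''R''" "s' ''idx'' = s ''idx''"
      "s' ''no'' = s ''no''" if "I l s'" for l s'
    using that by (auto simp: I_def same_outside_def)
  have cell: "runs (Seq prog_cell (Set ''x'' (Plus (Var ''x'') (N 1)))) s' 5
      (\<lambda>s'. s' ''i'' 0 = i \<and> s' ''j'' 0 = j \<and> I (i * m + Suc j) s')"
    if "i < m" "j < m" "s' ''i'' 0 = i" "s' ''j'' 0 = j" and I: "I (i * m + j) s'" for i j s'
  proof -
    have "(i * m + j) div m = i" "(i * m + j) mod m = j" using that(2) by auto
    then have E: "E (i * m + j) \<longleftrightarrow> (i, j) \<in> out_arcs s A" by (simp add: E_def)
    have I': "I (i * m + Suc j) (s'(''out'' := (s' ''out'')(3 + (i * m + j) := of_bool (E (i * m + j))),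
        ''x'' := (s' ''x'')(0 := 4 + (i * m + j))))"
      using I by (auto simp: I_def less_Suc_eq)
    have x: "s' ''x'' 0 = 3 + (i * m + j)" using I by (simp add: I_def)
    have arcs: "s ''in'' (s ''R'' (s ''idx'' i) + s ''idx'' j) = of_bool (E (i * m + j))"
      if "s ''no'' 0 \<noteq> 1"
    proof -
      have "s ''idx'' i < n" "s ''idx'' j < n" using idx[OF that] \<open>i < m\<close> \<open>j < m\<close> by auto
      then show ?thesis
        using ld that m E \<open>i < m\<close> \<open>j < m\<close> by (simp add: loaded_def out_arcs_def)
    qed
    have neg: "E (i * m + j) \<longleftrightarrow> i = j + 1 \<or> i + 1 < j" if "s ''no'' 0 = 1"
      using that E m \<open>i < m\<close> \<open>j < m\<close> by (auto simp: out_arcs_def reversed_path_def)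
    show ?thesis
      using I' x arcs neg I_D[OF I] that(3,4) unfolding prog_cell_def
      by (cases "s ''no'' 0 = 1"; cases "i = j + 1"; cases "i + 1 < j") (simp_all add: numeral_eq_Suc)
  qed
  have loop: "runs (For ''i'' (Var ''m'') (For ''j'' (Var ''m'')
      (Seq prog_cell (Set ''x'' (Plus (Var ''x'') (N 1)))))) s1 (m * (m * 7 + 4) + 2) (I (m * m))"
    if "I 0 s1" for s1
  proof (rule runs_For[where I = "\<lambda>i. I (i * m)" and m = m and T = "m * 7 + 2"])
    fix i s' assume i: "i < m" "I (i * m) s'" "s' ''i'' 0 = i"
    show "runs (For ''j'' (Var ''m'') (Seq prog_cell (Set ''x'' (Plus (Var ''x'') (N 1))))) s'
      (m * 7 + 2) (\<lambda>s'. s' ''i'' 0 = i \<and> I (Suc i * m) (s'(''i'' := (s' ''i'')(0 := Suc i))))"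
    proof (rule runs_For[where I = "\<lambda>j s'. s' ''i'' 0 = i \<and> I (i * m + j) s'" and m = m and T = 5])
      fix j s' assume "j < m" "s' ''i'' 0 = i \<and> I (i * m + j) s'" "s' ''j'' 0 = j"
      then show "runs (Seq prog_cell (Set ''x'' (Plus (Var ''x'') (N 1)))) s' 5
        (\<lambda>s'. s' ''j'' 0 = j \<and> (s'(''j'' := (s' ''j'')(0 := Suc j))) ''i'' 0 = i \<and>
           I (i * m + Suc j) (s'(''j'' := (s' ''j'')(0 := Suc j))))"
        using cell[of i j s'] i(1) by (intro runs_mono[OF cell[of i j s']]) (auto simp: I_upd)
    next
      fix s' assume "s' ''i'' 0 = i \<and> I (i * m + m) s'"
      then show "s' ''i'' 0 = i \<and> I (Suc i * m) (s'(''i'' := (s' ''i'')(0 := Suc i)))"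
        by (simp add: I_upd add.commute)
    qed (use i I_D m in \<open>auto simp: I_upd\<close>)
  next
    fix i s' assume "I (i * m) s'"
    then show "aval (Var ''m'') s' = m" using I_D(1) m by simp
  qed (use that in \<open>simp_all add: I_upd algebra_simps\<close>)
  show ?thesis
    unfolding prog_out_def runs_Seq_Assign
  proof (intro conjI, goal_cases)
    case 5
    show ?case
      by (rule runs_Seq[OF loop, where ?T2.0 = 1])
        (use m pk in \<open>simp_all add: I_def E_def\<close>)
  qed simp_all
qed

text \<open>If more than \<open>B\<close> vertices are kept, \<open>m\<close> becomes the size
  \<open>3 * K\<close> of the fixed no-instance, and the flag \<open>no\<close> makes
  \<open>prog_cell\<close> write its arcs instead of reading through \<open>idx\<close>.\<close>

definition prog :: com where
  "prog = Seq prog_K (Seq prog_B (Seq prog_R (Seq prog_twins (Seq prog_idx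
     (Seq (If (Less (Var ''B'') (Var ''m''))
        (Seq (Set ''no'' (N 1)) (Set ''m'' (Plus (Var ''K'') (Plus (Var ''K'') (Var ''K''))))) Skip)
     prog_out)))))"

lemma concat_map_upt_mult:
  "concat (map (\<lambda>i. map (\<lambda>j. g (i * m + j)) [0..<m]) [0..<r]) = map g [0..<r * m]"
proof (induction r)
  case (Suc r)
  have "map g [r * m..<r * m + m] = map (\<lambda>j. g (r * m + j)) [0..<m]"
    by (simp add: map_add_upt[symmetric, of _ m] comp_def add.commute)
  moreover have "[0..<r * m + m] = [0..<r * m] @ [r * m..<r * m + m]"
    by (rule upt_add_eq_append) simp
  ultimately show ?case using Suc by (simp add: add.commute)
qed simp

text \<open>The flat form of the matrix, matching the order in which \<open>prog_out\<close> fills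
  the output.\<close>

lemma encode_eq: "encode m A p k = [m, p, k] @ map (\<lambda>y. of_bool ((y div m, y mod m) \<in> A)) [0..<m * m]"
proof -
  have "concat (map (\<lambda>i. map (\<lambda>j. of_bool (((i * m + j) div m, (i * m + j) mod m) \<in> A) :: nat) [0..<m]) [0..<m])
    = concat (map (\<lambda>i. map (\<lambda>j. of_bool ((i, j) \<in> A)) [0..<m]) [0..<m])"
    by (intro arg_cong[of _ _ concat] map_cong) auto
  with concat_map_upt_mult[of "\<lambda>y. of_bool ((y div m, y mod m) \<in> A) :: nat" m m]
  show ?thesis by (simp add: encode_def)
qed

lemma length_encode: "length (encode n A p k) = 3 + n * n"
  by (simp add: encode_eq)

lemma out_list_eq_encode:
  assumes "s ''out'' 0 = m" "s ''out'' 1 = p" "s ''out'' 2 = k" "s ''outlen'' 0 = 3 + m * m"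
    and "\<forall>y<m * m. s ''out'' (3 + y) = of_bool ((y div m, y mod m) \<in> A)"
  shows "out_list s = encode m A p k"
proof (rule nth_equalityI)
  show "length (out_list s) = length (encode m A p k)"
    using assms by (simp add: out_list_def length_encode)
  fix i assume "i < length (out_list s)"
  then have i: "i < 3 + m * m" using assms by (simp add: out_list_def)
  consider "i = 0" | "i = 1" | "i = 2" | y where "i = 3 + y" "y < m * m"
  proof -
    have "i = 0 \<or> i = 1 \<or> i = 2 \<or> i = 3 + (i - 3) \<and> i - 3 < m * m"
      using i by arith
    then show ?thesis using that by blast
  qed
  then show "out_list s ! i = encode m A p k ! i"
    using i assms by cases (simp_all add: out_list_def encode_eq nth_append numeral_3_eq_3 numeral_2_eq_2 del: upt_Suc)
qed

section \<open>Correctness of the kernelization\<close>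

lemma runs_prog:
  fixes n p k A
  defines "K \<equiv> min n ((if p = 1 then 1 else k) * p)"
  defines "S \<equiv> twin_reduced K {..<n} A"
  assumes T: "tournament {..<n} A" and p: "1 \<le> p"
  shows "runs prog (init_state (encode n A p k)) (6 * n ^ 3 + 18 * n ^ 2 + 46 * n + 50)
    (\<lambda>s. \<exists>m A'. out_list s = encode m A' p k \<and> m \<le> n \<and>
       (if card S \<le> K * (K + 2)
        then \<exists>f. bij_betw f {..<m} S \<and> A' = {(i, j). i < m \<and> j < m \<and> (f i, f j) \<in> A}
        else m = 3 * K \<and> A' = reversed_path m))"
    (is "runs prog ?s ?T ?Q")
proof -
  have in0: "?s ''in'' 0 = n" "?s ''in'' 1 = p" "?s ''in'' 2 = k"
    by (simp_all add: init_state_def length_encode) (simp_all add: encode_eq)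
  have arcs: "?s ''in'' (3 + i * n + j) = of_bool ((i, j) \<in> A)" if "i < n" "j < n" for i j
  proof -
    have "i * n + j < n * n"
      using that mult_le_mono1[of "Suc i" n n] by simp
    then show ?thesis
      using that by (simp add: init_state_def length_encode encode_eq nth_append numeral_3_eq_3)
  qed
  have zero: "?s ''P'' = (\<lambda>_. 0)" "?s ''no'' = (\<lambda>_. 0)"
    by (simp_all add: init_state_def)
  have "K \<le> n" by (simp add: K_def)
  have S: "S \<subseteq> {..<n}" by (auto simp: S_def twin_reduced_def)
  then have "card S \<le> n" using card_mono[of "{..<n}" S] by simp
  show ?thesis
    unfolding prog_def
  proof (rule runs_Seq[OF runs_prog_K[where s = ?s, OF in0 p]])
    fix s1 assume "s1 ''K'' 0 = min n ((if p = 1 then 1 else k) * p) \<and> same_outside {''q'', ''K'', ''i''} ?s s1"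
    then have K1: "s1 ''K'' 0 = K" and "same_outside {''q'', ''K'', ''i''} ?s s1"
      by (simp_all add: K_def)
    then have s1: "s1 ''in'' = ?s ''in''" "s1 ''P'' = ?s ''P''" "s1 ''no'' = ?s ''no''"
      by (simp_all add: same_outside_def)
    show "runs (Seq prog_B (Seq prog_R (Seq prog_twins (Seq prog_idx
     (Seq (If (Less (Var ''B'') (Var ''m''))
        (Seq (Set ''no'' (N 1)) (Set ''m'' (Plus (Var ''K'') (Plus (Var ''K'') (Var ''K''))))) Skip)
     prog_out))))) s1 (6 * n ^ 3 + 18 * n ^ 2 + 36 * n + 40) ?Q"
    proof (rule runs_Seq[OF runs_mono[OF runs_prog_B[where s = s1, OF K1]], where ?T1.0 = "10 * n + 10"])
      fix s2 assume "s2 ''B'' 0 = K * (K + 2) \<and> same_outside {''B'', ''i''} s1 s2"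
      then have s2: "s2 ''B'' 0 = K * (K + 2)" "s2 ''in'' = ?s ''in''" "s2 ''P'' = ?s ''P''" "s2 ''no'' = ?s ''no''"
          "s2 ''K'' 0 = K"
        using s1 K1 by (simp_all add: same_outside_def)
      have "s2 ''in'' 0 = n" using s2 in0 by simp
      show "runs (Seq prog_R (Seq prog_twins (Seq prog_idx
         (Seq (If (Less (Var ''B'') (Var ''m''))
            (Seq (Set ''no'' (N 1)) (Set ''m'' (Plus (Var ''K'') (Plus (Var ''K'') (Var ''K''))))) Skip)
         prog_out)))) s2 (6 * n ^ 3 + 18 * n ^ 2 + 26 * n + 30) ?Q"
      proof (rule runs_Seq[OF runs_prog_R[where s = s2, OF \<open>s2 ''in'' 0 = n\<close>]])
        fix s3 assume *: "(\<forall>i<n. s3 ''R'' i = 3 + i * n) \<and> same_outside {''R'', ''x'', ''i''} s2 s3"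
        then have s3: "s3 ''B'' 0 = K * (K + 2)" "s3 ''in'' = ?s ''in''" "s3 ''P'' = ?s ''P''"
            "s3 ''no'' = ?s ''no''" "s3 ''K'' 0 = K"
          using s2 by (simp_all add: same_outside_def)
        have ld: "loaded n A s3" "s3 ''P'' = (\<lambda>_. 0)"
          using * s3 in0 arcs zero by (simp_all add: loaded_def)
        show "runs (Seq prog_twins (Seq prog_idx
           (Seq (If (Less (Var ''B'') (Var ''m''))
              (Seq (Set ''no'' (N 1)) (Set ''m'' (Plus (Var ''K'') (Plus (Var ''K'') (Var ''K''))))) Skip)
           prog_out))) s3 (6 * n ^ 3 + 18 * n ^ 2 + 16 * n + 20) ?Q"
        proof (rule runs_Seq[OF runs_prog_twins[OF T ld]])
          fix s4 assume *: "s4 ''P'' 0 = 0 \<and>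
            (\<forall>v u. s4 ''P'' (Suc v) = Suc u \<longleftrightarrow> (u, v) \<in> twins {..<n} A) \<and>
            same_outside {''v'', ''u'', ''ok'', ''w'', ''x'', ''P''} s3 s4"
          then have s4: "s4 ''B'' 0 = K * (K + 2)" "s4 ''in'' = ?s ''in''" "s4 ''no'' = ?s ''no''"
              "s4 ''K'' 0 = K" "s4 ''R'' = s3 ''R''"
            using s3 by (simp_all add: same_outside_def)
          have P: "s4 ''P'' 0 = 0" "\<And>v u. s4 ''P'' (Suc v) = Suc u \<longleftrightarrow> (u, v) \<in> twins {..<n} A"
              "s4 ''in'' 0 = n"
            using * s4 in0 by simp_all
          show "runs (Seq prog_idx
             (Seq (If (Less (Var ''B'') (Var ''m''))
                (Seq (Set ''no'' (N 1)) (Set ''m'' (Plus (Var ''K'') (Plus (Var ''K'') (Var ''K''))))) Skip)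
             prog_out)) s4 (10 * n ^ 2 + 12 * n + 18) ?Q"
          proof (rule runs_Seq[OF runs_mono[OF runs_prog_idx[where s = s4, OF P(1,2) s4(4) P(3)]],
                where ?T1.0 = "n * (n * 3 + 8) + 3" and ?T2.0 = "n * (n * 7 + 4) + 10"])
            fix s5 assume *: "bij_betw (s5 ''idx'') {..<s5 ''m'' 0} (twin_reduced K {..<n} A) \<and>
              same_outside {''i'', ''x'', ''m'', ''v'', ''idx''} s4 s5"
            then have s5: "s5 ''B'' 0 = K * (K + 2)" "s5 ''in'' = ?s ''in''" "s5 ''no'' 0 = 0"
                "s5 ''K'' 0 = K" "s5 ''R'' = s3 ''R''"
              using s4 zero by (simp_all add: same_outside_def)
            have bij: "bij_betw (s5 ''idx'') {..<s5 ''m'' 0} S" using * by (simp add: S_def)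
            then have m: "s5 ''m'' 0 = card S" using bij_betw_same_card by fastforce
            define s6 where "s6 = (if K * (K + 2) < card S
              then s5(''no'' := (s5 ''no'')(0 := 1), ''m'' := (s5 ''m'')(0 := 3 * K)) else s5)"
            define m' where "m' = s6 ''m'' 0"
            have "m' \<le> n"
            proof (cases "K * (K + 2) < card S")
              case True
              \<comment> \<open>The no-instance is not larger than the set it replaces, so the
                output stage stays within its budget in \<open>n\<close>.\<close>
              have "3 * K \<le> K * (K + 2)" by (cases K) simp_all
              then have "3 * K \<le> n" using True \<open>card S \<le> n\<close> by linarith
              then show ?thesis using True by (simp add: m'_def s6_def)
            qed (use m \<open>card S \<le> n\<close> in \<open>simp add: m'_def s6_def\<close>)
            have ld6: "loaded n A s6" using ld(1) s5 s3(2) by (simp add: loaded_def s6_def)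
            have in6: "s6 ''in'' 1 = p" "s6 ''in'' 2 = k" using s5 in0 by (simp_all add: s6_def)
            have idx6: "s6 ''idx'' ` {..<m'} \<subseteq> {..<n}" if "s6 ''no'' 0 \<noteq> 1"
              using that bij S by (auto simp: bij_betw_def s6_def m'_def split: if_splits)
            have out: "runs prog_out s6 (m' * (m' * 7 + 4) + 7) ?Q"
            proof (rule runs_mono[OF runs_prog_out[where s = s6, OF ld6 m'_def[symmetric] in6 idx6]])
              fix s7 assume "s7 ''out'' 0 = m' \<and> s7 ''out'' 1 = p \<and> s7 ''out'' 2 = k \<and>
                s7 ''outlen'' 0 = 3 + m' * m' \<and>
                (\<forall>y<m' * m'. s7 ''out'' (3 + y) = of_bool ((y div m', y mod m') \<in> out_arcs s6 A))"
              then have "out_list s7 = encode m' (out_arcs s6 A) p k"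
                by (intro out_list_eq_encode) simp_all
              then show "?Q s7"
                using \<open>m' \<le> n\<close> bij s5(3)
                by (intro exI[of _ m'] exI[of _ "out_arcs s6 A"])
                  (auto simp: out_arcs_def s6_def m'_def intro!: exI[of _ "s5 ''idx''"])
            qed simp_all
            have "runs prog_out s6 (n * (n * 7 + 4) + 7) ?Q"
              by (rule runs_mono[OF out]) (use \<open>m' \<le> n\<close> in \<open>auto intro!: mult_le_mono add_mono\<close>)
            then show "runs (Seq (If (Less (Var ''B'') (Var ''m''))
                (Seq (Set ''no'' (N 1)) (Set ''m'' (Plus (Var ''K'') (Plus (Var ''K'') (Var ''K''))))) Skip)
               prog_out) s5 (n * (n * 7 + 4) + 10) ?Q"
              using s5 m by (auto simp: s6_def numeral_3_eq_3 elim!: runs_mono)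
          qed (use \<open>K \<le> n\<close> in \<open>simp_all add: power2_eq_square algebra_simps\<close>)
        qed (simp add: power2_eq_square power3_eq_cube algebra_simps)
      qed simp
    next
      show "10 * K + 10 \<le> 10 * n + 10" using \<open>K \<le> n\<close> by simp
      show "10 * n + 10 + (6 * n ^ 3 + 18 * n ^ 2 + 26 * n + 30) \<le> 6 * n ^ 3 + 18 * n ^ 2 + 36 * n + 40"
        by simp
    qed
  qed simp
qed

text \<open>A chain of \<open>K\<close> links has \<open>K + 1\<close> distinct vertices and does
  not fit into \<open>V\<close>. Hence truncating \<open>K\<close> at the number of vertices does
  not change the kept set.\<close>

lemma twin_reduced_eq_self:
  assumes "tournament V A" "card V \<le> K"
  shows "twin_reduced K V A = V"
proof -
  have "v \<notin> Range (twins V A ^^ K)" if "v \<in> V" for v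
  proof
    assume "v \<in> Range (twins V A ^^ K)"
    then obtain c where c: "c K = v" "\<And>i. i < K \<Longrightarrow> (c i, c (Suc i)) \<in> twins V A"
      by (auto simp: relpow_fun_conv)
    have "c 0 \<in> V"
      using c(2)[of 0] c(1) that by (cases K) (auto simp: twins_def)
    then interpret ch: twin_chain V A c K
      using assms(1) c(2) by unfold_locales
    have "card (c ` {..K}) = Suc K" using ch.inj by (simp add: card_image)
    moreover have "card (c ` {..K}) \<le> card V"
      using assms(1) ch.in_V by (intro card_mono) (auto simp: tournament_def)
    ultimately show False using assms(2) by simp
  qed
  then show ?thesis by (auto simp: twin_reduced_def)
qed

text \<open>For \<open>p\<close> at least 2, both \<open>k * p + 2 \<le> 2 * (p * k)\<close> and
  \<open>2 \<le> p\<close> hold, which gives the factor \<open>p * (p * k)\<close>. For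
  \<open>p = 1\<close>, \<open>K\<close> is 1 and the left side is 3.\<close>

lemma kernel_size_le:
  fixes p k :: nat
  assumes "1 \<le> p" "1 \<le> k"
  defines "K \<equiv> (if p = 1 then 1 else k) * p"
  shows "K * (K + 2) \<le> max 3 (k ^ 2 * p ^ 3)"
proof (cases "p = 1")
  case False
  then have "2 \<le> p" using assms by simp
  have "2 * 1 \<le> p * k" using \<open>2 \<le> p\<close> assms(2) by (rule mult_le_mono)
  then have "k * p + 2 \<le> 2 * (p * k)" by (simp add: mult.commute)
  also have "\<dots> \<le> p * (p * k)" using \<open>2 \<le> p\<close> by (rule mult_le_mono1)
  finally have "(k * p) * (k * p + 2) \<le> (k * p) * (p * (p * k))" by (rule mult_le_mono2)
  also have "\<dots> = k ^ 2 * p ^ 3" by (simp add: power2_eq_square power3_eq_cube)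
  finally show ?thesis using False by (simp add: K_def)
qed (simp add: K_def)

lemma admits_kernel_solvable:
  assumes C: "\<And>p n. C p n \<Longrightarrow> n \<le> p" and \<epsilon>: "\<epsilon> \<ge> (0 :: real)"
  shows "admits_kernel (\<lambda>V A p k. solvable (C p) V A k)
    (\<lambda>p k. max 3 ((1 + \<epsilon>) * real k ^ 2 * real p ^ 3))"
  unfolding admits_kernel_def
\<comment> \<open>The steps and the output length together are at most
  \<open>100 * (n + 1) ^ 3\<close>, and the input has at least \<open>n + 1\<close> entries.\<close>
proof (intro exI[of _ prog] exI[of _ "monom 100 3"] allI impI; elim conjE)
  fix n p k :: nat and A assume T: "tournament {..<n} A" and pk: "1 \<le> p" "1 \<le> k"
  define q where "q = (if p = 1 then 1 else k)"
  define K where "K = q * p"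
  define S where "S = twin_reduced K {..<n} A"
  have "K > 0" using pk by (simp add: K_def q_def)
  have q: "solvable (C p) V B k \<longleftrightarrow> solvable (C p) V B q" if "finite V" for V :: "nat set" and B
    using solvable_size_1[OF that, of "C p"] C[of p] by (auto simp: q_def)
  have S_eq: "twin_reduced (min n K) {..<n} A = S"
    using twin_reduced_eq_self[OF T] by (auto simp: S_def min_def)
  have SV: "S \<subseteq> {..<n}" by (auto simp: S_def twin_reduced_def)
  \<comment> \<open>If the truncation took effect, the threshold would be
    \<open>n * (n + 2)\<close>, which \<open>card S\<close> cannot exceed. So the no-instance is
    only written with the true \<open>K\<close>, for which it is known to be unsolvable.\<close>
  have S_large: "min n K = K" if "min n K * (min n K + 2) < card S"
  proof (rule ccontr)
    assume "min n K \<noteq> K"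
    then have "min n K = n" by (simp add: min_def split: if_splits)
    moreover have "card S \<le> n" using card_mono[OF _ SV] by simp
    moreover have "n \<le> n * (n + 2)" by simp
    ultimately show False using that by simp
  qed
  obtain t s m A' where run: "exec prog (init_state (encode n A p k)) t s"
      "t \<le> 6 * n ^ 3 + 18 * n ^ 2 + 46 * n + 50" "out_list s = encode m A' p k" "m \<le> n"
    and res: "if card S \<le> min n K * (min n K + 2)
        then \<exists>f. bij_betw f {..<m} S \<and> A' = {(i, j). i < m \<and> j < m \<and> (f i, f j) \<in> A}
        else m = 3 * min n K \<and> A' = reversed_path m"
    using runs_prog[OF T pk(1), of k] unfolding runs_def K_def[symmetric] q_def[symmetric] S_eq by blast
  have comp: "computes_in_time prog (encode n A p k) (encode m A' p k) (t + (3 + m * m))"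
    unfolding computes_in_time_def using run by (intro exI[of _ t] exI[of _ s]) (simp add: length_encode)
  have time: "t + (3 + m * m) \<le> poly (monom 100 3) (bit_size (encode n A p k))"
  proof -
    have "length xs \<le> bit_size xs" for xs
      by (induction xs) (auto simp: bit_size_def)
    from this[of "encode n A p k"] have "n + 1 \<le> bit_size (encode n A p k)"
      using le_square[of n] unfolding length_encode by linarith
    then have "(n + 1) ^ 3 \<le> bit_size (encode n A p k) ^ 3" by (rule power_mono) simp
    moreover have "m * m \<le> n ^ 2"
      using run(4) by (simp add: power2_eq_square mult_le_mono)
    moreover have "(n + 1) ^ 3 = n ^ 3 + 3 * n ^ 2 + 3 * n + 1"
      by (simp add: power2_eq_square power3_eq_cube algebra_simps)
    ultimately show ?thesis using run(2) unfolding poly_monom by linarith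
  qed
  have m_le: "m \<le> K * (K + 2) \<and> tournament {..<m} A' \<and>
      (solvable (C p) {..<m} A' q \<longleftrightarrow> solvable (C p) {..<n} A q)"
  proof (cases "card S \<le> min n K * (min n K + 2)")
    case True
    then obtain f where f: "bij_betw f {..<m} S" and A': "A' = {(i, j). i < m \<and> j < m \<and> (f i, f j) \<in> A}"
      using res by auto
    have "m = card S" using bij_betw_same_card[OF f] by simp
    also have "\<dots> \<le> K * (K + 2)"
      by (rule order_trans[OF True]) (intro mult_le_mono add_mono; simp)
    finally have "m \<le> K * (K + 2)" .
    have TS: "tournament S (Restr A S)" by (rule tournament_Restr[OF T SV])
    have fS: "i < m \<Longrightarrow> f i \<in> S" for i using f by (auto simp: bij_betw_def)
    have f_inj: "i < m \<Longrightarrow> j < m \<Longrightarrow> f i = f j \<longleftrightarrow> i = j" for i j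
      using f by (auto simp: bij_betw_def inj_on_def)
    have TA: "tournament {..<m} A'"
      unfolding tournament_def
    proof (intro conjI)
      show "asym A'" using T by (auto simp: A' tournament_def asym_on_def)
      show "total_on {..<m} A'"
      proof (rule total_onI)
        fix i j assume ij: "i \<in> {..<m}" "j \<in> {..<m}" "i \<noteq> j"
        then have "f i \<noteq> f j" "f i \<in> S" "f j \<in> S" using f_inj fS by auto
        then have "(f i, f j) \<in> A \<or> (f j, f i) \<in> A"
          using TS by (auto simp: tournament_def total_on_def)
        then show "(i, j) \<in> A' \<or> (j, i) \<in> A'" using ij by (auto simp: A')
      qed
    qed (auto simp: A')
    have "solvable (C p) {..<m} A' q \<longleftrightarrow> solvable (C p) S (Restr A S) q"
      by (rule solvable_relabel_iff[OF f _ tournament_irrefl[OF TA] _ tournament_irrefl[OF TS]])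
        (auto simp: A' fS)
    also have "\<dots> \<longleftrightarrow> solvable (C p) {..<n} A q"
      unfolding S_def by (rule solvable_restrict_to_twin_reduced[OF T \<open>K > 0\<close> K_def C])
    finally show ?thesis using \<open>m \<le> K * (K + 2)\<close> TA by simp
  next
    case False
    then have min: "min n K = K" using S_large by simp
    then have m: "m = 3 * K" "A' = reversed_path (3 * K)" using res False by auto
    have "\<not> solvable (C p) {..<n} A q"
      using card_twin_reduced_le[OF T _ C K_def] False min by (auto simp: S_def)
    moreover have "\<not> solvable (C p) {..<m} A' q"
      unfolding m by (rule not_solvable_reversed_path[OF C K_def[symmetric] \<open>K > 0\<close>])
    moreover have "m \<le> K * (K + 2)" using \<open>K > 0\<close> m(1) by (cases K) simp_all
    ultimately show ?thesis using tournament_reversed_path m by simp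
  qed
  have "m \<le> max 3 (k ^ 2 * p ^ 3)"
    using m_le kernel_size_le[OF pk] unfolding K_def q_def by linarith
  then have "real m \<le> max 3 (real k ^ 2 * real p ^ 3)"
    by (metis of_nat_le_iff of_nat_max of_nat_mult of_nat_numeral of_nat_power)
  also have "\<dots> \<le> max 3 ((1 + \<epsilon>) * real k ^ 2 * real p ^ 3)"
    using \<epsilon> mult_right_mono[of 1 "1 + \<epsilon>" "real k ^ 2 * real p ^ 3"]
    by (intro max.mono) (simp_all add: mult.assoc)
  finally show "\<exists>n' A' t. computes_in_time prog (encode n A p k) (encode n' A' p k) t \<and>
      t \<le> poly (monom 100 3) (bit_size (encode n A p k)) \<and> tournament {..<n'} A' \<and>
      (solvable (C p) {..<n'} A' k \<longleftrightarrow> solvable (C p) {..<n} A k) \<and>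
      real n' \<le> max 3 ((1 + \<epsilon>) * real k ^ 2 * real p ^ 3)"
    using comp time m_le q by blast
qed

theorem theorem1p12:
  fixes \<epsilon> :: real
  assumes "\<epsilon> > 0"
  shows "admits_kernel bounded_size_inversion
           (\<lambda>p k. max 3 ((1 + \<epsilon>) * real k ^ 2 * real p ^ 3)) \<and>
         admits_kernel prescribed_size_inversion
           (\<lambda>p k. max 3 ((1 + \<epsilon>) * real k ^ 2 * real p ^ 3))"
proof -
  have "(bounded_size_inversion :: nat set \<Rightarrow> _) = (\<lambda>V A p k. solvable (\<lambda>c. c \<le> p) V A k)"
    "(prescribed_size_inversion :: nat set \<Rightarrow> _) = (\<lambda>V A p k. solvable (\<lambda>c. c = p) V A k)"
    by (simp_all add: fun_eq_iff solvable_def bounded_size_inversion_def prescribed_size_inversion_def)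
  then show ?thesis
    using admits_kernel_solvable[of "\<lambda>p c. c \<le> p" \<epsilon>] admits_kernel_solvable[of "\<lambda>p c. c = p" \<epsilon>] assms
    by simp
qed

end
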